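(* Let $n$ be odd, let $a_1,\dots,a_n$ be nonzero real numbers, and let $H_n$ be the Schroedinger operator with edge weights $a_1,\dots,a_n$. Let $\delta\in(0,1)$ and $0<\lambda<\left(\frac{\delta}{16n}\right)^{2/\delta}$. Let $M_n^\lambda$ be the number of eigenvalues of $H_n$ in the interval $(0,\lambda)$. Let $D_n^{1\pm\delta}$ be the number of $(1\pm\delta)|\log\lambda|$-downcrossings made by the process $k\mapsto\sum_{i=1}^{k}\log\left|\frac{a_{2i-1}}{a_{2i}}\right|$, $k=0,1,\dots,\frac{n-1}{2}$. Let $B_n^\delta$ be the number of $k\in\{1,\dots,n\}$ for which $\big|\log|a_k|\big|>\frac{\delta}{8}|\log\lambda|$. Then $$D_n^{1+\delta}-2B_n^\delta\le M_n^\lambda\le D_n^{1-\delta}+2B_n^\delta .$$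
   Context: $H_n$ is the symmetric $(n+1)\times(n+1)$ matrix with $(H_n)_{i,i+1}=(H_n)_{i+1,i}=a_i$ for $1\le i\le n$ and all other entries $0$. Crossings: let $X$ be a real function on a discrete or continuous time set starting at $0$, and put $M(t_1,t_2)=\max_{t\in[t_1,t_2]}X(t)$, $m(t_1,t_2)=\min_{t\in[t_1,t_2]}X(t)$. For $\alpha>0$ let $\tau_0=0$ and for $i\ge1$ $$\tau_{2i-1}=\inf\{s\ge\tau_{2i-2}: M(\tau_{2i-2},s)-X(s)\ge\alpha\},\qquad \tau_{2i}=\inf\{s\ge\tau_{2i-1}: m(\tau_{2i-1},s)-X(s)\le-\alpha\},$$ where $s$ ranges over the time set. $X$ makes an $\alpha$-downcrossing at each (existing) time $\tau_{2i-1}$ and an $\alpha$-upcrossing at each (existing) time $\tau_{2i}$. The empty sum (for $k=0$) equals $0$. *)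

theory Defs
  imports Complex_Main "HOL-Library.Extended_Nat" "Jordan_Normal_Form.Char_Poly"
begin

(* Rows and columns are numbered from 0 here, so the edge weight a k (1 <= k <= n)
   joins the indices k - 1 and k. *)
definition schroedinger_mat :: "nat \<Rightarrow> (nat \<Rightarrow> real) \<Rightarrow> real mat" where
  "schroedinger_mat n a = mat (n + 1) (n + 1)
     (\<lambda>(i, j). if j = i + 1 then a j else if i = j + 1 then a i else 0)"

(* Distinct eigenvalues are counted. When all a k are nonzero, H_n is a symmetric
   tridiagonal matrix with nonzero off-diagonal entries and its eigenvalues are simple,
   so the number is the same as the number counted with multiplicity. *)
definition num_eigenvalues_in :: "real mat \<Rightarrow> real set \<Rightarrow> nat" where
  "num_eigenvalues_in A I = card {x \<in> I. eigenvalue A x}"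

definition running_max :: "(nat \<Rightarrow> real) \<Rightarrow> enat \<Rightarrow> nat \<Rightarrow> real" where
  "running_max X t s = Max {X u | u. t \<le> enat u \<and> u \<le> s}"

definition running_min :: "(nat \<Rightarrow> real) \<Rightarrow> enat \<Rightarrow> nat \<Rightarrow> real" where
  "running_min X t s = Min {X u | u. t \<le> enat u \<and> u \<le> s}"

(* The times tau_j for a function X on the time set {0, ..., N}. An infimum over the empty
   set is \<infinity>, which encodes that the crossing time does not exist; all later times are then
   \<infinity> as well. The step from an even to an odd index is a downcrossing, the step from an odd
   to an even index an upcrossing. *)
primrec crossing_time :: "nat \<Rightarrow> (nat \<Rightarrow> real) \<Rightarrow> real \<Rightarrow> nat \<Rightarrow> enat" where
  "crossing_time N X \<alpha> 0 = 0"
| "crossing_time N X \<alpha> (Suc j) =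
     (let t = crossing_time N X \<alpha> j in
      if even j
      then Inf {enat s | s. s \<le> N \<and> t \<le> enat s \<and> running_max X t s - X s \<ge> \<alpha>}
      else Inf {enat s | s. s \<le> N \<and> t \<le> enat s \<and> running_min X t s - X s \<le> - \<alpha>})"

definition num_downcrossings :: "nat \<Rightarrow> (nat \<Rightarrow> real) \<Rightarrow> real \<Rightarrow> nat" where
  "num_downcrossings N X \<alpha> = card {i. i \<ge> 1 \<and> crossing_time N X \<alpha> (2 * i - 1) < \<infinity>}"

definition log_ratio_process :: "(nat \<Rightarrow> real) \<Rightarrow> nat \<Rightarrow> real" where
  "log_ratio_process a k = (\<Sum>i = 1..k. ln \<bar>a (2 * i - 1) / a (2 * i)\<bar>)"

end

theory Submission
  imports
    Defs
    "HOL-Computational_Algebra.Fundamental_Theorem_Algebra"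
    "HOL-Analysis.Convex"
begin

text \<open>
  Write \<open>n + 1 = 2 * m\<close>. The matrix exchanges the even and the odd indices, so it consists of a
  bidiagonal \<open>m\<close> by \<open>m\<close> block \<open>A\<close> (\<open>half_op\<close>) and its transpose, and its positive eigenvalues are
  the singular values of \<open>A\<close>. The number of singular values below \<open>lam\<close> is bounded by the two halves
  of the min-max principle: it is at most the number of linear constraints that force
  \<open>lam * norm x \<le> norm (A x)\<close> (\<open>card_small_singular_values_le\<close>), and at least the dimension of any
  space on which \<open>norm (A x) < lam * norm x\<close> for \<open>x \<noteq> 0\<close> (\<open>card_small_singular_values_ge\<close>).

  The equation \<open>A x = 0\<close> without its first row is solved by \<open>h j / a (2 * j + 1)\<close>, where
  \<open>\<bar>h j\<bar> = exp (- X j)\<close> and \<open>X\<close> is the process of the theorem (\<open>zero_mode\<close>, \<open>abs_zero_mode\<close>).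
  Writing \<open>x j = h j / a (2 * j + 1) * \<xi> j\<close> turns \<open>A\<close> into a difference operator,
  \<open>(A x) j = h j * (\<xi> j - \<xi> (j - 1))\<close> (\<open>half_op_zero_mode_mult\<close>), and both bounds become statements
  about \<open>X\<close>.

  If \<open>x\<close> vanishes next to \<open>j\<close> on a suitable side, summing the differences from there to \<open>j\<close> gives
  \<open>x j\<close> as a combination of the values of \<open>A x\<close> with coefficients, up to sign, \<open>exp (X k - X j) / a (2 * j + 1)\<close>.
  In a phase that ends with a downcrossing one sums from the left, in a phase that ends with
  an upcrossing from the right; then no coefficient is large, because a large one would be a crossing
  before the crossing time. One zero of \<open>x\<close> at the end of each of the latter phases suffices, that is,
  one constraint for each downcrossing (\<open>downcrossing_barriers\<close>, \<open>half_op_lower_bound\<close>).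

  Conversely, a downcrossing and the upcrossing after it enclose a valley of \<open>X\<close>. The solution
  above, cut off to the valley, is large at its bottom, and its image under \<open>A\<close> lives on the two
  edges, where it is small. Different valleys are disjoint, so these vectors span a space of the
  required dimension (\<open>downcrossing_valleys\<close>, \<open>half_op_test_functions\<close>).

  The weights \<open>a (2 * j + 1)\<close> and the Cauchy-Schwarz constants cost factors that the change of the
  level from \<open>\<bar>ln lam\<bar>\<close> to \<open>(1 \<plusminus> \<delta>) * \<bar>ln lam\<bar>\<close> absorbs, as \<open>n * lam powr (\<delta> / 2) < 1 / 16\<close>. A weight
  with \<open>\<bar>ln \<bar>a k\<bar>\<bar> > \<delta> / 8 * \<bar>ln lam\<bar>\<close> is removed at the price of one more constraint or of one test
  vector.
\<close>


section \<open>Crossing times\<close>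

lemma Inf_enat_le_iff_ex:
  "Inf {enat s |s. P s} \<le> enat t \<longleftrightarrow> (\<exists>s\<le>t. P s)"
proof
  assume le: "Inf {enat s |s. P s} \<le> enat t"
  have "\<exists>s. P s"
  proof (rule ccontr)
    assume "\<nexists>s. P s"
    then have "{enat s |s. P s} = {}" by simp
    with le show False by (simp add: Inf_enat_def)
  qed
  then obtain s where "enat s \<in> {enat s |s. P s}" by blast
  then have "Inf {enat s |s. P s} \<in> {enat s |s. P s}"
    by (rule wellorder_InfI)
  then obtain s where "P s" "Inf {enat s |s. P s} = enat s" by blast
  with le show "\<exists>s\<le>t. P s" by auto
next
  assume "\<exists>s\<le>t. P s"
  then obtain s where "s \<le> t" "P s" by blast
  then show "Inf {enat s |s. P s} \<le> enat t"
    by (intro Inf_lower2[of "enat s"]) auto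
qed

lemma running_max_ge_iff:
  "t \<le> s \<and> running_max X (enat t) s - X s \<ge> \<alpha> \<longleftrightarrow> (\<exists>u\<in>{t..s}. X u - X s \<ge> \<alpha>)"
proof (cases "t \<le> s")
  case True
  have "{X u |u. enat t \<le> enat u \<and> u \<le> s} = X ` {t..s}" by auto
  then have "running_max X (enat t) s \<ge> \<alpha> + X s \<longleftrightarrow> (\<exists>u\<in>{t..s}. X u \<ge> \<alpha> + X s)"
    unfolding running_max_def using True by (simp add: Max_ge_iff)
  with True show ?thesis by (simp add: le_diff_eq)
qed simp

lemma running_min_le_iff:
  "t \<le> s \<and> running_min X (enat t) s - X s \<le> - \<alpha> \<longleftrightarrow> (\<exists>u\<in>{t..s}. X s - X u \<ge> \<alpha>)"
proof (cases "t \<le> s")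
  case True
  have "{X u |u. enat t \<le> enat u \<and> u \<le> s} = X ` {t..s}" by auto
  then have "running_min X (enat t) s \<le> X s - \<alpha> \<longleftrightarrow> (\<exists>u\<in>{t..s}. X u \<le> X s - \<alpha>)"
    unfolding running_min_def using True by (simp add: Min_le_iff)
  with True show ?thesis by (simp add: algebra_simps)
qed simp

text \<open>The running extrema are attained, so a crossing is witnessed by a pair of times. This form of
  the recursion makes up- and downcrossings symmetric and removes the infimum.\<close>
lemma crossing_time_Suc_le_iff:
  assumes "crossing_time N X \<alpha> j = enat t"
  shows "crossing_time N X \<alpha> (Suc j) \<le> enat s' \<longleftrightarrow>
    (\<exists>s\<le>s'. s \<le> N \<and> (\<exists>u\<in>{t..s}. (if even j then X u - X s else X s - X u) \<ge> \<alpha>))"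
  using assms by (simp add: Let_def Inf_enat_le_iff_ex running_max_ge_iff running_min_le_iff)

lemma crossing_time_Suc_infinity:
  assumes "crossing_time N X \<alpha> j = \<infinity>"
  shows "crossing_time N X \<alpha> (Suc j) = \<infinity>"
  using assms by (simp add: top_enat_def)

declare crossing_time.simps(2) [simp del]

lemma crossing_time_Suc_finite:
  assumes "crossing_time N X \<alpha> (Suc j) = enat s" "0 < \<alpha>"
  obtains t u where "crossing_time N X \<alpha> j = enat t" "t \<le> u" "u < s" "s \<le> N"
    "(if even j then X u - X s else X s - X u) \<ge> \<alpha>"
proof -
  obtain t where t: "crossing_time N X \<alpha> j = enat t"
    using assms crossing_time_Suc_infinity by (metis not_enat_eq enat.distinct(1))
  from assms crossing_time_Suc_le_iff[OF t, of s] obtain s' u where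
    u: "u \<in> {t..s'}" "s' \<le> s" "s' \<le> N"
      "(if even j then X u - X s' else X s' - X u) \<ge> \<alpha>"
    by auto
  then have "crossing_time N X \<alpha> (Suc j) \<le> enat s'"
    unfolding crossing_time_Suc_le_iff[OF t] by blast
  with assms u have "s' = s" by simp
  moreover have "u \<noteq> s'" using u assms(2) by (auto split: if_splits)
  ultimately show ?thesis by (intro that[OF t, of u]) (use u in auto)
qed

text \<open>The quantitative content of a phase: between two consecutive crossing times the process does not
  move by \<open>\<alpha>\<close> in the direction that would end the phase.\<close>
lemma no_crossing_before_crossing_time:
  assumes "crossing_time N X \<alpha> j = enat t" "enat s < crossing_time N X \<alpha> (Suc j)"
    "t \<le> u" "u \<le> s" "s \<le> N"
  shows "(if even j then X u - X s else X s - X u) < \<alpha>"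
proof (rule ccontr)
  assume "\<not> ?thesis"
  then have "(if even j then X u - X s else X s - X u) \<ge> \<alpha>" by linarith
  with assms have "crossing_time N X \<alpha> (Suc j) \<le> enat s"
    unfolding crossing_time_Suc_le_iff[OF assms(1)] by (intro exI[of _ s]) auto
  with assms(2) show False by simp
qed

lemma crossing_time_finite_mono:
  assumes "crossing_time N X \<alpha> k \<noteq> \<infinity>" "j \<le> k"
  shows "crossing_time N X \<alpha> j \<noteq> \<infinity>"
  using assms(2,1)
proof (induction rule: inc_induct)
  case (step n)
  then show ?case using crossing_time_Suc_infinity[of N X \<alpha> n]
    by (cases "crossing_time N X \<alpha> n") auto
qed

lemma crossing_time_ge_index:
  assumes "0 < \<alpha>" "crossing_time N X \<alpha> j = enat s"
  shows "j \<le> s \<and> s \<le> N"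
  using assms(2)
proof (induction j arbitrary: s)
  case (Suc j)
  from Suc.prems assms(1) obtain t u where
    "crossing_time N X \<alpha> j = enat t" "t \<le> u" "u < s" "s \<le> N"
    by (rule crossing_time_Suc_finite)
  with Suc.IH[of t] show ?case by simp
qed (simp add: zero_enat_def)

text \<open>A crossing time exists only if all earlier ones do, so the indices of the existing downcrossings
  form an initial segment. It is finite because the crossing times increase strictly within
  \<open>{0..N}\<close>; this needs \<open>\<alpha> > 0\<close>. The downcrossing of index \<open>i = r + 1\<close> in the definition is counted
  by \<open>r\<close> here.\<close>
lemma downcrossing_exists_iff:
  assumes "0 < \<alpha>"
  shows "crossing_time N X \<alpha> (Suc (2 * r)) \<noteq> \<infinity> \<longleftrightarrow> r < num_downcrossings N X \<alpha>"
proof -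
  define I where "I = {r. crossing_time N X \<alpha> (Suc (2 * r)) \<noteq> \<infinity>}"
  have "r \<le> N" if "r \<in> I" for r
    using that crossing_time_ge_index[OF assms, of N X "Suc (2 * r)"] unfolding I_def by auto
  then have fin: "finite I"
    by (intro finite_subset[of I "{..N}"]) auto
  have down: "r' \<in> I" if "r \<in> I" "r' \<le> r" for r r'
    using crossing_time_finite_mono[of N X \<alpha> "Suc (2 * r)" "Suc (2 * r')"] that
    by (simp add: I_def)
  have "i \<ge> 1 \<and> crossing_time N X \<alpha> (2 * i - 1) < \<infinity> \<longleftrightarrow> i \<in> Suc ` I" for i
    by (cases i) (auto simp: I_def image_iff)
  then have "{i. i \<ge> 1 \<and> crossing_time N X \<alpha> (2 * i - 1) < \<infinity>} = Suc ` I"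
    by blast
  then have "num_downcrossings N X \<alpha> = card I"
    by (simp add: num_downcrossings_def card_image)
  moreover have "r \<in> I \<longleftrightarrow> r < card I"
  proof (cases "I = {}")
    case False
    have "I = {..Max I}"
    proof
      show "I \<subseteq> {..Max I}" using fin by auto
      show "{..Max I} \<subseteq> I" using down[OF Max_in[OF fin False]] by blast
    qed
    then show ?thesis by (metis card_atMost atMost_iff less_Suc_eq_le)
  qed simp
  ultimately show ?thesis by (simp add: I_def)
qed

lemma last_crossing_time_before:
  assumes "0 < \<alpha>"
  obtains k t where "crossing_time N X \<alpha> k = enat t" "t \<le> j" "enat j < crossing_time N X \<alpha> (Suc k)"
proof -
  define P where "P = (\<lambda>k. crossing_time N X \<alpha> k \<le> enat j)"
  have P: "k \<le> j" if "P k" for k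
  proof -
    obtain t where t: "crossing_time N X \<alpha> k = enat t" "t \<le> j"
      using \<open>P k\<close> unfolding P_def by (metis enat_ile enat_ord_simps(1))
    with crossing_time_ge_index[OF assms t(1)] show ?thesis by simp
  qed
  have "P 0" by (simp add: P_def)
  define k where "k = (GREATEST k. P k)"
  have "P k" unfolding k_def using GreatestI_nat[of P 0 j] P \<open>P 0\<close> by blast
  moreover have "\<not> P (Suc k)"
    using Greatest_le_nat[of P "Suc k" j] P unfolding k_def by fastforce
  ultimately show ?thesis
    using that unfolding P_def by (metis enat_ile enat_ord_simps(1) not_le_imp_less)
qed

text \<open>The barriers are the last times of the phases that start with a downcrossing, one for each
  downcrossing: \<open>\<tau> - 1\<close> for the following upcrossing time \<open>\<tau>\<close>, or \<open>N\<close> if there is none. Any time \<open>j\<close>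
  lies in a phase in which the process either does not fall by \<open>\<alpha>\<close>, and then all times from the start
  \<open>c\<close> of the phase, which comes right after a barrier, up to \<open>j\<close> have bounded \<open>X k - X j\<close>; or it does
  not rise by \<open>\<alpha>\<close>, and then the same holds for the times after \<open>j\<close> up to the barrier that ends the
  phase.\<close>
lemma downcrossing_barriers:
  assumes "0 < \<alpha>"
  obtains Z where "Z \<subseteq> {..N}" "card Z \<le> num_downcrossings N X \<alpha>"
    "\<And>j. j \<le> N \<Longrightarrow>
       (\<exists>c\<le>j. (c = 0 \<or> c - 1 \<in> Z) \<and> (\<forall>k\<in>{c..j}. X k - X j < \<alpha>)) \<or>
       (\<exists>e\<ge>j. e \<in> Z \<and> (\<forall>k\<in>{j<..e}. X k - X j < \<alpha>))"
proof -
  let ?T = "crossing_time N X \<alpha>"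
  define D where "D = num_downcrossings N X \<alpha>"
  define z where "z q = (case ?T (Suc (Suc (2 * q))) of enat t \<Rightarrow> t - 1 | \<infinity> \<Rightarrow> N)" for q
  have "z q \<le> N" for q
    using crossing_time_ge_index[OF assms, of N X "Suc (Suc (2 * q))"]
    unfolding z_def by (auto split: enat.split)
  then have "z ` {..<D} \<subseteq> {..N}" by auto
  moreover have "card (z ` {..<D}) \<le> D"
    by (metis card_image_le card_lessThan finite_lessThan)
  moreover have "(\<exists>c\<le>j. (c = 0 \<or> c - 1 \<in> z ` {..<D}) \<and> (\<forall>k\<in>{c..j}. X k - X j < \<alpha>)) \<or>
       (\<exists>e\<ge>j. e \<in> z ` {..<D} \<and> (\<forall>k\<in>{j<..e}. X k - X j < \<alpha>))" if "j \<le> N" for j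
  proof -
    obtain k t where k: "?T k = enat t" "t \<le> j" "enat j < ?T (Suc k)"
      using last_crossing_time_before[OF assms] .
    show ?thesis
    proof (cases "even k")
      case True
      then obtain q where q: "k = 2 * q" by (elim evenE)
      have "X u - X j < \<alpha>" if "u \<in> {t..j}" for u
        using no_crossing_before_crossing_time[OF k(1,3), of u] that True \<open>j \<le> N\<close> by simp
      moreover have "t = 0 \<or> t - 1 \<in> z ` {..<D}"
      proof (cases q)
        case 0
        then show ?thesis using k(1) q by (simp add: zero_enat_def)
      next
        case (Suc p)
        have "?T (Suc (2 * p)) \<noteq> \<infinity>"
          using crossing_time_finite_mono[of N X \<alpha> k "Suc (2 * p)"] k(1) q Suc by simp
        then have "p < D" unfolding D_def downcrossing_exists_iff[OF assms] .
        moreover have "z p = t - 1" using k(1) by (simp add: z_def q Suc)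
        ultimately show ?thesis by (metis imageI lessThan_iff)
      qed
      ultimately show ?thesis using k(2) by blast
    next
      case False
      then obtain q where q: "k = Suc (2 * q)" by (auto elim: oddE)
      have "q < D" using k(1) q downcrossing_exists_iff[OF assms, of N X q] by (simp add: D_def)
      moreover have "j \<le> z q" using k(3) \<open>j \<le> N\<close>
        unfolding z_def q by (auto split: enat.split)
      moreover have "X u - X j < \<alpha>" if "u \<in> {j<..z q}" for u
      proof -
        have "enat u < ?T (Suc k)" using that k(3)
          unfolding z_def q by (auto split: enat.splits)
        then show ?thesis
          using no_crossing_before_crossing_time[OF k(1), of u j] that k(2) False \<open>z q \<le> N\<close> by simp
      qed
      ultimately show ?thesis by blast
    qed
  qed
  ultimately show ?thesis using that unfolding D_def by blast
qed

text \<open>Each downcrossing yields a valley: an edge \<open>i\<close> from which the process falls by \<open>\<alpha>\<close> to the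
  bottom \<open>l\<close>, and the next upcrossing time \<open>e\<close>, or \<open>N + 1\<close> if there is none. The downcrossing time
  itself need not be a good bottom, since the upcrossing is measured from the minimum after it; the
  lower of the two is good for both edges.\<close>
lemma downcrossing_valleys:
  assumes "0 < \<alpha>"
  obtains i l e :: "nat \<Rightarrow> nat" where
    "\<And>r. r < num_downcrossings N X \<alpha> \<Longrightarrow>
       i r \<le> l r \<and> l r < e r \<and> l r \<le> N \<and> X (i r) - X (l r) \<ge> \<alpha> \<and>
       (e r \<le> N \<longrightarrow> X (e r) - X (l r) \<ge> \<alpha>)"
    "\<And>r r'. r < r' \<Longrightarrow> r' < num_downcrossings N X \<alpha> \<Longrightarrow> e r \<le> i r'"
proof -
  let ?T = "crossing_time N X \<alpha>"
  define D where "D = num_downcrossings N X \<alpha>"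
  define Q where "Q r i l e \<longleftrightarrow> ?T (2 * r) \<le> enat i \<and> i \<le> l \<and> l < e \<and> l \<le> N \<and>
       X i - X l \<ge> \<alpha> \<and> (e \<le> N \<longrightarrow> X e - X l \<ge> \<alpha>) \<and>
       (?T (2 * Suc r) = enat e \<or> ?T (2 * Suc r) = \<infinity>)" for r i l e
  have ex: "\<exists>i l e. Q r i l e" if "r < D" for r
  proof -
    have "?T (Suc (2 * r)) \<noteq> \<infinity>"
      using that by (simp only: D_def downcrossing_exists_iff[OF assms])
    then obtain s where s: "?T (Suc (2 * r)) = enat s" by auto
    obtain t i where i: "?T (2 * r) = enat t" "t \<le> i" "i < s" "s \<le> N" "X i - X s \<ge> \<alpha>"
      by (rule crossing_time_Suc_finite[OF s assms]) auto
    show ?thesis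
    proof (cases "?T (2 * Suc r)")
      case (enat e)
      then have e: "?T (Suc (Suc (2 * r))) = enat e" by simp
      obtain s' u where u: "?T (Suc (2 * r)) = enat s'" "s' \<le> u" "u < e" "e \<le> N" "X e - X u \<ge> \<alpha>"
        by (rule crossing_time_Suc_finite[OF e assms]) auto
      show ?thesis
      proof (cases "X u \<le> X s")
        case True
        show ?thesis unfolding Q_def
          by (rule exI[of _ i], rule exI[of _ u], rule exI[of _ e]) (use i u s enat True in auto)
      next
        case False
        show ?thesis unfolding Q_def
          by (rule exI[of _ i], rule exI[of _ s], rule exI[of _ e]) (use i u s enat False in auto)
      qed
    next
      case infinity
      show ?thesis unfolding Q_def
        by (rule exI[of _ i], rule exI[of _ s], rule exI[of _ "Suc N"]) (use i s infinity in auto)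
    qed
  qed
  then obtain i l e where "\<And>r. r < D \<Longrightarrow> Q r (i r) (l r) (e r)"
    by metis
  note ile = this[unfolded Q_def]
  have "e r \<le> i (r + Suc p)" if "r + Suc p < D" for r p
    using that
  proof (induction p)
    case 0
    have "?T (2 * Suc r) \<le> enat (i (Suc r))" using ile[of "Suc r"] 0 by auto
    moreover have "?T (2 * Suc r) = enat (e r) \<or> ?T (2 * Suc r) = \<infinity>" using ile[of r] 0 by auto
    ultimately show ?case by auto
  next
    case (Suc p)
    have "?T (2 * Suc (r + Suc p)) \<le> enat (i (Suc (r + Suc p)))"
      using ile[of "Suc (r + Suc p)"] Suc.prems by auto
    moreover have "?T (2 * Suc (r + Suc p)) = enat (e (r + Suc p)) \<or> ?T (2 * Suc (r + Suc p)) = \<infinity>"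
      using ile[of "r + Suc p"] Suc.prems by auto
    ultimately have "e (r + Suc p) \<le> i (Suc (r + Suc p))" by auto
    moreover have "i (r + Suc p) < e (r + Suc p)" using ile[of "r + Suc p"] Suc.prems by auto
    ultimately show ?case using Suc by simp
  qed
  then have disj: "e r \<le> i r'" if "r < r'" "r' < D" for r r'
    using that less_iff_Suc_add[of r r'] by auto
  show ?thesis
    by (rule that[of i l e]) (use ile disj in \<open>auto simp: D_def\<close>)
qed

section \<open>Homogeneous systems and orthogonal families\<close>

text \<open>Gaussian elimination: each step uses one equation to eliminate one unknown.\<close>
lemma homogeneous_system_nontrivial_solution:
  fixes v :: "'i \<Rightarrow> 'j \<Rightarrow> 'a::field"
  assumes "finite J" "finite F" "card J < card F"
  obtains c where "\<exists>f\<in>F. c f \<noteq> 0" "\<And>j. j \<in> J \<Longrightarrow> (\<Sum>f\<in>F. c f * v f j) = 0"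
proof -
  have "\<exists>c. (\<exists>f\<in>F. c f \<noteq> 0) \<and> (\<forall>j\<in>J. (\<Sum>f\<in>F. c f * v f j) = 0)"
    using assms
  proof (induction J arbitrary: F v rule: finite_induct)
    case empty
    then have "F \<noteq> {}" by auto
    then show ?case by (intro exI[of _ "\<lambda>_. 1"]) auto
  next
    case (insert j0 J)
    show ?case
    proof (cases "\<forall>f\<in>F. v f j0 = 0")
      case True
      moreover have "\<exists>c. (\<exists>f\<in>F. c f \<noteq> 0) \<and> (\<forall>j\<in>J. (\<Sum>f\<in>F. c f * v f j) = 0)"
        using insert by (intro insert.IH) auto
      ultimately show ?thesis by auto
    next
      case False
      then obtain g where g: "g \<in> F" "v g j0 \<noteq> 0" by blast
      define v' where "v' f j = v f j - v f j0 / v g j0 * v g j" for f j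
      have "\<exists>c. (\<exists>f\<in>F - {g}. c f \<noteq> 0) \<and> (\<forall>j\<in>J. (\<Sum>f\<in>F - {g}. c f * v' f j) = 0)"
        using insert g by (intro insert.IH) auto
      then obtain c where c: "\<exists>f\<in>F - {g}. c f \<noteq> 0"
        "\<And>j. j \<in> J \<Longrightarrow> (\<Sum>f\<in>F - {g}. c f * v' f j) = 0"
        by blast
      \<comment> \<open>The coefficient of \<open>g\<close> is the one that solves the equation \<open>j0\<close>.\<close>
      define c' where "c' = c(g := - (\<Sum>f\<in>F - {g}. c f * (v f j0 / v g j0)))"
      have eq: "(\<Sum>f\<in>F. c' f * v f j) = (\<Sum>f\<in>F - {g}. c f * v' f j)" for j
      proof -
        have "(\<Sum>f\<in>F. c' f * v f j) = c' g * v g j + (\<Sum>f\<in>F - {g}. c' f * v f j)"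
          using g insert.prems by (intro sum.remove) auto
        also have "(\<Sum>f\<in>F - {g}. c' f * v f j) = (\<Sum>f\<in>F - {g}. c f * v f j)"
          by (intro sum.cong) (auto simp: c'_def)
        finally show ?thesis
          by (simp add: c'_def v'_def algebra_simps sum_subtractf sum_distrib_left sum_distrib_right)
      qed
      have "(\<Sum>f\<in>F - {g}. c f * v' f j0) = 0" using g by (simp add: v'_def)
      with c(2) eq have "\<forall>j\<in>insert j0 J. (\<Sum>f\<in>F. c' f * v f j) = 0" by auto
      moreover have "\<exists>f\<in>F. c' f \<noteq> 0" using c(1) by (auto simp: c'_def)
      ultimately show ?thesis by blast
    qed
  qed
  with that show ?thesis by blast
qed

lemma sum_square_orthogonal_combination:
  fixes v :: "'s \<Rightarrow> 'j \<Rightarrow> real"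
  assumes "finite S"
    and "\<And>s t. s \<in> S \<Longrightarrow> t \<in> S \<Longrightarrow> (\<Sum>j\<in>J. v s j * v t j) = (if s = t then W s else 0)"
  shows "(\<Sum>j\<in>J. (\<Sum>s\<in>S. c s * v s j)\<^sup>2) = (\<Sum>s\<in>S. (c s)\<^sup>2 * W s)"
proof -
  have "(\<Sum>j\<in>J. (\<Sum>s\<in>S. c s * v s j)\<^sup>2) = (\<Sum>j\<in>J. \<Sum>s\<in>S. \<Sum>t\<in>S. c s * v s j * (c t * v t j))"
    by (simp only: power2_eq_square sum_product)
  also have "\<dots> = (\<Sum>s\<in>S. \<Sum>j\<in>J. \<Sum>t\<in>S. c s * v s j * (c t * v t j))"
    by (rule sum.swap)
  also have "\<dots> = (\<Sum>s\<in>S. \<Sum>t\<in>S. \<Sum>j\<in>J. c s * v s j * (c t * v t j))"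
    by (intro sum.cong refl sum.swap)
  also have "\<dots> = (\<Sum>s\<in>S. \<Sum>t\<in>S. c s * c t * (\<Sum>j\<in>J. v s j * v t j))"
    by (simp add: sum_distrib_left mult_ac)
  also have "\<dots> = (\<Sum>s\<in>S. \<Sum>t\<in>S. if t = s then (c s)\<^sup>2 * W s else 0)"
    using assms(2) by (intro sum.cong refl) (auto simp: power2_eq_square)
  also have "\<dots> = (\<Sum>s\<in>S. (c s)\<^sup>2 * W s)"
    using assms(1) by (simp add: sum.delta)
  finally show ?thesis .
qed

section \<open>The eigenvalues of the matrix\<close>

lemma card_roots_rsquarefree:
  fixes p :: "complex poly"
  assumes "rsquarefree p"
  shows "card {z. poly p z = 0} = degree p"
proof -
  have p: "p \<noteq> 0" using assms by (simp add: rsquarefree_def)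
  have "degree p = degree (Polynomial.smult (lead_coeff p) (\<Prod>z|poly p z = 0. [:-z, 1:]))"
    by (simp only: complex_poly_decompose_rsquarefree[OF assms])
  also have "\<dots> = card {z. poly p z = 0}"
    using p by (simp add: degree_prod_sum_eq)
  finally show ?thesis ..
qed

text \<open>The value at \<open>x\<close> of the polynomial with index \<open>k\<close> is the \<open>k\<close>-th coordinate of the solution of the
  eigenvalue equation for \<open>x\<close> that starts with \<open>1\<close>, the rows being solved one after the other. These
  are the orthonormal polynomials of the Jacobi matrix with off-diagonal entries \<open>a\<close> and zero diagonal.
  The polynomial of index \<open>n + 1\<close> measures the failure of the last row, and so vanishes exactly at
  the eigenvalues.\<close>
fun eigen_poly :: "(nat \<Rightarrow> 'a::field) \<Rightarrow> nat \<Rightarrow> 'a poly" where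
  "eigen_poly a 0 = 1"
| "eigen_poly a (Suc 0) = [:0, 1 / a 1:]"
| "eigen_poly a (Suc (Suc k)) =
     Polynomial.smult (1 / a (Suc (Suc k))) (pCons 0 (eigen_poly a (Suc k)) - Polynomial.smult (a (Suc k)) (eigen_poly a k))"

lemma eigen_poly_recurrence:
  assumes "a (Suc k) \<noteq> 0"
  shows "a (Suc k) * poly (eigen_poly a (Suc k)) z =
    z * poly (eigen_poly a k) z - (if k = 0 then 0 else a k * poly (eigen_poly a (k - 1)) z)"
  using assms by (cases k) auto

lemma degree_eigen_poly:
  assumes "\<forall>i\<in>{1..k}. a i \<noteq> 0"
  shows "degree (eigen_poly a k) = k"
proof -
  have "(\<forall>i>k. coeff (eigen_poly a k) i = 0) \<and> coeff (eigen_poly a k) k \<noteq> 0"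
    using assms
  proof (induction a k rule: eigen_poly.induct)
    case (2 a)
    then show ?case by (auto simp: coeff_pCons split: nat.split)
  next
    case (3 a k)
    then have "(\<forall>i>Suc k. coeff (eigen_poly a (Suc k)) i = 0) \<and> coeff (eigen_poly a (Suc k)) (Suc k) \<noteq> 0"
      "(\<forall>i>k. coeff (eigen_poly a k) i = 0) \<and> coeff (eigen_poly a k) k \<noteq> 0"
      by auto
    with 3(3) show ?case by (auto simp: coeff_pCons split: nat.split)
  qed auto
  then show ?thesis
    by (metis degree_le le_antisym le_degree)
qed

lemma poly_eigen_poly_minus:
  "poly (eigen_poly a k) (- z) = (-1) ^ k * poly (eigen_poly a k) z"
  by (induction a k rule: eigen_poly.induct) (auto simp: algebra_simps)

lemma poly_eigen_poly_even_0:
  assumes "\<forall>i\<in>{1..2 * m}. a i \<noteq> 0"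
  shows "poly (eigen_poly a (2 * m)) 0 \<noteq> 0"
  using assms by (induction m) auto

lemma poly_eigen_poly_of_real:
  "poly (eigen_poly (\<lambda>i. of_real (a i)) k) (of_real x) =
    (of_real (poly (eigen_poly a k) x) :: 'a::real_field)"
  by (induction a k rule: eigen_poly.induct) auto

lemma poly_eigen_poly_cnj:
  "poly (eigen_poly (\<lambda>i. complex_of_real (a i)) k) (cnj z) =
    cnj (poly (eigen_poly (\<lambda>i. complex_of_real (a i)) k) z)"
  by (induction a k rule: eigen_poly.induct) auto

text \<open>The Christoffel-Darboux identity. It gives the three properties of the eigenvalues used below: with
  \<open>w = cnj z\<close> they are real, in the limit \<open>w = z\<close> they are simple, and for two different ones
  the eigenvectors are orthogonal.\<close>
lemma christoffel_darboux:
  assumes "\<forall>i\<in>{1..Suc K}. a i \<noteq> 0"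
  shows "(z - w) * (\<Sum>k\<le>K. poly (eigen_poly a k) z * poly (eigen_poly a k) w) =
    a (Suc K) * (poly (eigen_poly a (Suc K)) z * poly (eigen_poly a K) w
      - poly (eigen_poly a K) z * poly (eigen_poly a (Suc K)) w)"
  using assms
proof (induction K)
  case 0
  then show ?case by (simp add: field_simps)
next
  case (Suc K)
  let ?P = "\<lambda>k. poly (eigen_poly a k)"
  have IH: "(z - w) * (\<Sum>k\<le>K. ?P k z * ?P k w) =
      a (Suc K) * (?P (Suc K) z * ?P K w - ?P K z * ?P (Suc K) w)"
    using Suc by auto
  have nz: "a (Suc (Suc K)) \<noteq> 0" using Suc.prems by auto
  have rec: "a (Suc (Suc K)) * ?P (Suc (Suc K)) x = x * ?P (Suc K) x - a (Suc K) * ?P K x" for x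
    using eigen_poly_recurrence[where a = a and k = "Suc K", OF nz] by simp
  have "a (Suc (Suc K)) * (?P (Suc (Suc K)) z * ?P (Suc K) w - ?P (Suc K) z * ?P (Suc (Suc K)) w) =
      (a (Suc (Suc K)) * ?P (Suc (Suc K)) z) * ?P (Suc K) w
      - ?P (Suc K) z * (a (Suc (Suc K)) * ?P (Suc (Suc K)) w)"
    by (simp only: algebra_simps)
  also have "\<dots> = (z - w) * (?P (Suc K) z * ?P (Suc K) w) +
      a (Suc K) * (?P (Suc K) z * ?P K w - ?P K z * ?P (Suc K) w)"
    unfolding rec by (simp add: algebra_simps del: eigen_poly.simps)
  also have "\<dots> = (z - w) * (\<Sum>k\<le>Suc K. ?P k z * ?P k w)"
    unfolding IH[symmetric] by (simp add: algebra_simps del: eigen_poly.simps)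
  finally show ?case ..
qed

lemma eigen_poly_root_real:
  assumes "\<forall>i\<in>{1..Suc n}. a i \<noteq> 0"
    and "poly (eigen_poly (\<lambda>i. complex_of_real (a i)) (Suc n)) z = 0"
  shows "z \<in> \<real>"
proof -
  let ?P = "\<lambda>k. poly (eigen_poly (\<lambda>i. complex_of_real (a i)) k)"
  have "(z - cnj z) * (\<Sum>k\<le>n. ?P k z * ?P k (cnj z)) = 0"
    using assms(1) by (subst christoffel_darboux)
      (auto simp: poly_eigen_poly_cnj assms(2) simp del: eigen_poly.simps)
  moreover have "(\<Sum>k\<le>n. ?P k z * ?P k (cnj z)) = of_real (\<Sum>k\<le>n. (cmod (?P k z))\<^sup>2)"
    by (simp only: poly_eigen_poly_cnj complex_norm_square of_real_sum)
  moreover have "(\<Sum>k\<le>n. (cmod (?P k z))\<^sup>2) > 0"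
    by (rule sum_pos2[of _ 0]) auto
  ultimately have "z = cnj z" by (auto simp del: of_real_sum)
  then show ?thesis by (metis Reals_cnj_iff)
qed

text \<open>As a function of \<open>w\<close>, the Christoffel-Darboux sum at a root \<open>z\<close> times \<open>w - z\<close> is a multiple of the
  polynomial. At a double root the sum would vanish at \<open>w = z\<close>, but there it is a sum of squares of
  reals, one of which is \<open>1\<close>.\<close>
lemma eigen_poly_rsquarefree:
  assumes nz: "\<forall>i\<in>{1..Suc n}. a i \<noteq> 0"
  shows "rsquarefree (eigen_poly (\<lambda>i. complex_of_real (a i)) (Suc n))"
proof -
  define \<alpha> where "\<alpha> = (\<lambda>i. complex_of_real (a i))"
  let ?P = "\<lambda>k. poly (eigen_poly \<alpha> k)"
  have nz': "\<forall>i\<in>{1..Suc n}. \<alpha> i \<noteq> 0" using nz by (simp add: \<alpha>_def)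
  have "poly (pderiv (eigen_poly \<alpha> (Suc n))) z \<noteq> 0" if root: "?P (Suc n) z = 0" for z
  proof
    assume deriv: "poly (pderiv (eigen_poly \<alpha> (Suc n))) z = 0"
    from root have "z \<in> \<real>"
      using eigen_poly_root_real[OF nz] by (simp add: \<alpha>_def del: eigen_poly.simps)
    then obtain x where x: "z = of_real x" by (auto elim: Reals_cases)
    define q where "q = (\<Sum>k\<le>n. Polynomial.smult (?P k z) (eigen_poly \<alpha> k))"
    have "[:- z, 1:] * q = Polynomial.smult (\<alpha> (Suc n) * ?P n z) (eigen_poly \<alpha> (Suc n))"
    proof (rule poly_eq_poly_eq_iff[THEN iffD1], rule ext)
      fix w
      have "poly ([:- z, 1:] * q) w = (w - z) * (\<Sum>k\<le>n. ?P k w * ?P k z)"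
        by (simp add: q_def poly_sum algebra_simps)
      also have "\<dots> = \<alpha> (Suc n) * (?P (Suc n) w * ?P n z)"
        using nz' by (subst christoffel_darboux) (auto simp: root simp del: eigen_poly.simps)
      finally show "poly ([:- z, 1:] * q) w = poly (Polynomial.smult (\<alpha> (Suc n) * ?P n z) (eigen_poly \<alpha> (Suc n))) w"
        by (simp add: mult_ac del: eigen_poly.simps)
    qed
    then have "poly (pderiv ([:- z, 1:] * q)) z = 0"
      by (simp add: pderiv_smult deriv del: eigen_poly.simps)
    then have "poly q z = 0"
      unfolding pderiv_mult by (simp add: pderiv_pCons)
    moreover have "poly q z = of_real (\<Sum>k\<le>n. (poly (eigen_poly a k) x)\<^sup>2)"
      by (simp add: q_def poly_sum x \<alpha>_def poly_eigen_poly_of_real power2_eq_square)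
    moreover have "(\<Sum>k\<le>n. (poly (eigen_poly a k) x)\<^sup>2) > 0"
      by (rule sum_pos2[of _ 0]) auto
    ultimately show False by (simp del: of_real_sum)
  qed
  then show ?thesis unfolding rsquarefree_roots \<alpha>_def by blast
qed

text \<open>There are as many different real eigenvalues as rows. This is what makes the eigenvectors a basis
  and replaces the spectral theorem.\<close>
lemma card_eigen_poly_roots:
  fixes a :: "nat \<Rightarrow> real"
  assumes nz: "\<forall>i\<in>{1..Suc n}. a i \<noteq> 0"
  shows "finite {x. poly (eigen_poly a (Suc n)) x = 0}"
    and "card {x. poly (eigen_poly a (Suc n)) x = 0} = Suc n"
proof -
  let ?p = "eigen_poly (\<lambda>i. complex_of_real (a i)) (Suc n)"
  let ?R = "{x. poly (eigen_poly a (Suc n)) x = 0}"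
  have "{z. poly ?p z = 0} = complex_of_real ` ?R"
  proof (intro Set.set_eqI iffI)
    fix z assume z: "z \<in> {z. poly ?p z = 0}"
    then obtain x where "z = of_real x"
      using eigen_poly_root_real[OF nz] by (auto elim!: Reals_cases simp del: eigen_poly.simps)
    with z show "z \<in> complex_of_real ` ?R"
      by (auto simp: poly_eigen_poly_of_real simp del: eigen_poly.simps)
  qed (auto simp: poly_eigen_poly_of_real simp del: eigen_poly.simps)
  moreover have card: "card {z. poly ?p z = 0} = Suc n"
    using nz by (simp add: card_roots_rsquarefree[OF eigen_poly_rsquarefree[OF nz]] degree_eigen_poly
        del: eigen_poly.simps)
  moreover have "inj_on complex_of_real ?R" by (auto intro: inj_onI)
  ultimately show "card ?R = Suc n" by (simp add: card_image del: eigen_poly.simps)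
  then show "finite ?R" by (metis card.infinite nat.distinct(1))
qed

lemma schroedinger_mat_mult_vec:
  assumes "v \<in> carrier_vec (n + 1)" "i \<le> n"
  shows "(schroedinger_mat n a *\<^sub>v v) $ i =
    (if i = 0 then 0 else a i * v $ (i - 1)) + (if i < n then a (Suc i) * v $ (Suc i) else 0)"
proof -
  have "(schroedinger_mat n a *\<^sub>v v) $ i =
      (\<Sum>j<n + 1. (if j = i + 1 then a j else if i = j + 1 then a i else 0) * v $ j)"
    using assms by (auto simp: schroedinger_mat_def scalar_prod_def atLeast0LessThan)
  also have "\<dots> = (\<Sum>j<n + 1. (if j = i - 1 then if i = 0 then 0 else a i * v $ j else 0) +
      (if j = Suc i then a (Suc i) * v $ j else 0))"
    by (intro sum.cong refl) auto
  also have "\<dots> = (if i = 0 then 0 else a i * v $ (i - 1)) +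
      (if i < n then a (Suc i) * v $ (Suc i) else 0)"
    using assms by (simp add: sum.distrib del: sum.lessThan_Suc)
  finally show ?thesis .
qed

lemma eigenvalue_schroedinger_mat_iff:
  assumes nz: "\<forall>i\<in>{1..Suc n}. a i \<noteq> 0"
  shows "eigenvalue (schroedinger_mat n a) x \<longleftrightarrow> poly (eigen_poly a (Suc n)) x = 0"
proof -
  let ?P = "\<lambda>k. poly (eigen_poly a k) x"
  let ?H = "schroedinger_mat n a"
  have dim: "dim_row ?H = n + 1" "dim_col ?H = n + 1"
    by (simp_all add: schroedinger_mat_def)
  have rec: "a (Suc k) * ?P (Suc k) = x * ?P k - (if k = 0 then 0 else a k * ?P (k - 1))" if "k \<le> n" for k
    using that nz by (intro eigen_poly_recurrence) auto
  show ?thesis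
  proof
    assume "eigenvalue ?H x"
    then obtain v where v: "v \<in> carrier_vec (n + 1)" "v \<noteq> 0\<^sub>v (n + 1)" "?H *\<^sub>v v = x \<cdot>\<^sub>v v"
      unfolding eigenvalue_def eigenvector_def dim by blast
    have row: "x * v $ i = (if i = 0 then 0 else a i * v $ (i - 1)) +
        (if i < n then a (Suc i) * v $ (Suc i) else 0)" if "i \<le> n" for i
      using schroedinger_mat_mult_vec[OF v(1) that, of a] v that by simp
    have vP: "v $ k = v $ 0 * ?P k" if "k \<le> n" for k
      using that
    proof (induction k rule: less_induct)
      case (less k)
      show ?case
      proof (cases k)
        case (Suc j)
        have "a (Suc j) * v $ (Suc j) = x * v $ j - (if j = 0 then 0 else a j * v $ (j - 1))"
          using row[of j] less.prems Suc by auto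
        also have "\<dots> = v $ 0 * (x * ?P j - (if j = 0 then 0 else a j * ?P (j - 1)))"
          using less.IH[of j] less.IH[of "j - 1"] less.prems Suc by (simp add: algebra_simps)
        also have "\<dots> = v $ 0 * (a (Suc j) * ?P (Suc j))"
          using less.prems Suc by (subst rec) simp_all
        finally have "a (Suc j) * v $ (Suc j) = a (Suc j) * (v $ 0 * ?P (Suc j))"
          by (simp only: mult_ac)
        then show ?thesis using nz less.prems Suc by (simp del: eigen_poly.simps)
      qed simp
    qed
    have "v $ 0 \<noteq> 0"
    proof
      assume "v $ 0 = 0"
      have "v $ k = 0" if "k \<le> n" for k
        using vP[OF that] \<open>v $ 0 = 0\<close> by simp
      then have "v = 0\<^sub>v (n + 1)" using v(1) by (intro eq_vecI) auto
      with v(2) show False ..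
    qed
    have "v $ 0 * (a (Suc n) * ?P (Suc n)) =
        v $ 0 * (x * ?P n - (if n = 0 then 0 else a n * ?P (n - 1)))"
      using rec[of n] by simp
    also have "\<dots> = x * v $ n - (if n = 0 then 0 else a n * v $ (n - 1))"
      using vP[of n] vP[of "n - 1"] by (simp add: algebra_simps)
    also have "\<dots> = 0" using row[of n] by simp
    finally show "?P (Suc n) = 0" using nz \<open>v $ 0 \<noteq> 0\<close> by simp
  next
    assume root: "?P (Suc n) = 0"
    define v where "v = vec (n + 1) ?P"
    have v: "v \<in> carrier_vec (n + 1)" by (simp add: v_def)
    have "v $ 0 \<noteq> 0" by (simp add: v_def)
    then have "v \<noteq> 0\<^sub>v (n + 1)" by auto
    moreover have "?H *\<^sub>v v = x \<cdot>\<^sub>v v"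
    proof (rule eq_vecI)
      fix i assume "i < dim_vec (x \<cdot>\<^sub>v v)"
      then have i: "i \<le> n" by (simp add: v_def)
      have "(if i < n then a (Suc i) * v $ (Suc i) else 0) = a (Suc i) * ?P (Suc i)"
        using i root by (auto simp: v_def not_less simp del: eigen_poly.simps dest: le_antisym)
      then show "(?H *\<^sub>v v) $ i = (x \<cdot>\<^sub>v v) $ i"
        unfolding schroedinger_mat_mult_vec[OF v i] using rec[OF i] i
        by (auto simp: v_def simp del: eigen_poly.simps)
    qed (simp add: dim v_def)
    ultimately show "eigenvalue ?H x"
      using v unfolding eigenvalue_def eigenvector_def dim by blast
  qed
qed

lemma sum_lessThan_double:
  "(\<Sum>k<2 * m. f k) = (\<Sum>j<m. f (2 * j)) + (\<Sum>j<m. f (2 * j + 1 :: nat) :: 'a::comm_monoid_add)"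
  by (induction m) (auto simp: add_ac)

section \<open>Singular values of the bidiagonal block\<close>

text \<open>The block \<open>A\<close> of the matrix that maps the odd to the even coordinates: \<open>x j\<close> is the coordinate
  with index \<open>2 * j + 1\<close>, and the \<open>j\<close>-th coordinate of the image has index \<open>2 * j\<close>.\<close>
definition half_op :: "(nat \<Rightarrow> real) \<Rightarrow> (nat \<Rightarrow> real) \<Rightarrow> nat \<Rightarrow> real" where
  "half_op a x j = a (2 * j + 1) * x j + (if j = 0 then 0 else a (2 * j) * x (j - 1))"

lemma half_op_sum:
  "half_op a (\<lambda>j. \<Sum>s\<in>S. c s * v s j) j = (\<Sum>s\<in>S. c s * half_op a (v s) j)"
  by (simp add: half_op_def sum_distrib_left algebra_simps flip: sum.distrib)

text \<open>The roots are symmetric about \<open>0\<close>, which is not one of them, so \<open>m\<close> of the \<open>2 * m\<close> are positive.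
  The odd halves \<open>w s\<close> of their eigenvectors are orthogonal, and so are the images
  \<open>s * u s\<close>, where \<open>u s\<close> is the even half: the orthogonality of the
  eigenvectors of \<open>s\<close> to those of \<open>t\<close> and of \<open>- t\<close> gives the vanishing of the sum and of the
  difference of the even and the odd part of the inner product. For \<open>t = s\<close>, the difference
  shows that both halves have the same norm.\<close>
lemma singular_value_expansion:
  fixes a :: "nat \<Rightarrow> real"
  assumes nz: "\<forall>i\<in>{1..2 * m}. a i \<noteq> 0" and m: "m > 0"
  defines "S \<equiv> {x. 0 < x \<and> poly (eigen_poly a (2 * m)) x = 0}"
  obtains W w where "finite S" "card S = m" "\<And>s. s \<in> S \<Longrightarrow> W s > 0"
    "\<And>c. (\<Sum>j<m. (\<Sum>s\<in>S. c s * w s j)\<^sup>2) = (\<Sum>s\<in>S. (c s)\<^sup>2 * W s)"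
    "\<And>c. (\<Sum>j<m. (half_op a (\<lambda>j. \<Sum>s\<in>S. c s * w s j) j)\<^sup>2) = (\<Sum>s\<in>S. s\<^sup>2 * (c s)\<^sup>2 * W s)"
proof -
  obtain n where n: "2 * m = Suc n" using m by (cases "2 * m") auto
  let ?P = "\<lambda>k. poly (eigen_poly a k)"
  define R where "R = {x. ?P (2 * m) x = 0}"
  have R: "finite R" "card R = 2 * m"
    using card_eigen_poly_roots[of n a] nz unfolding n R_def by auto
  have "S \<subseteq> R" by (auto simp: S_def R_def)
  then have finS: "finite S" using R(1) by (rule finite_subset)
  have "R = S \<union> uminus ` S"
  proof (intro Set.set_eqI iffI)
    fix x assume "x \<in> R"
    then have "x \<noteq> 0" using poly_eigen_poly_even_0[OF nz] by (auto simp: R_def)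
    moreover have "- x \<in> R" using \<open>x \<in> R\<close> by (simp add: R_def poly_eigen_poly_minus)
    ultimately show "x \<in> S \<union> uminus ` S"
      using \<open>x \<in> R\<close> by (cases "x > 0") (auto simp: S_def R_def intro!: image_eqI[of _ _ "- x"])
  qed (auto simp: S_def R_def poly_eigen_poly_minus)
  moreover have "S \<inter> uminus ` S = {}" by (auto simp: S_def)
  ultimately have "card R = 2 * card S"
    using finS by (simp add: card_Un_disjoint card_image)
  with R have cardS: "card S = m" by simp
  define u where "u s j = ?P (2 * j) s" for s j
  define w where "w s j = ?P (2 * j + 1) s" for s j
  define W where "W s = (\<Sum>j<m. (w s j)\<^sup>2)" for s
  have CD: "(\<Sum>k<2 * m. ?P k x * ?P k y) = 0" if "x \<in> R" "y \<in> R" "x \<noteq> y" for x y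
  proof -
    have "(x - y) * (\<Sum>k\<le>n. ?P k x * ?P k y) = 0"
      using nz that by (subst christoffel_darboux) (auto simp: R_def n simp del: eigen_poly.simps)
    with that show ?thesis by (simp add: n lessThan_Suc_atMost)
  qed
  have orth: "(\<Sum>j<m. w s j * w t j) = (if s = t then W s else 0)"
    "(\<Sum>j<m. u s j * u t j) = (if s = t then W s else 0)" if "s \<in> S" "t \<in> S" for s t
  proof -
    have st: "s \<in> R" "t \<in> R" "- t \<in> R" "s \<noteq> - t"
      using that by (auto simp: S_def R_def poly_eigen_poly_minus)
    have "(\<Sum>k<2 * m. ?P k s * ?P k (- t)) = (\<Sum>j<m. u s j * u t j) - (\<Sum>j<m. w s j * w t j)"
      unfolding sum_lessThan_double
      by (simp add: poly_eigen_poly_minus u_def w_def sum_negf del: eigen_poly.simps)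
    with CD[OF st(1,3,4)] have eq: "(\<Sum>j<m. u s j * u t j) = (\<Sum>j<m. w s j * w t j)" by simp
    have "(\<Sum>k<2 * m. ?P k s * ?P k t) = (\<Sum>j<m. u s j * u t j) + (\<Sum>j<m. w s j * w t j)"
      unfolding sum_lessThan_double by (simp add: u_def w_def del: eigen_poly.simps)
    with CD[OF st(1,2)] eq have "s \<noteq> t \<Longrightarrow> (\<Sum>j<m. w s j * w t j) = 0" by simp
    then show "(\<Sum>j<m. w s j * w t j) = (if s = t then W s else 0)"
      by (auto simp: W_def power2_eq_square)
    with eq show "(\<Sum>j<m. u s j * u t j) = (if s = t then W s else 0)" by simp
  qed
  have W: "W s > 0" if "s \<in> S" for s
  proof -
    have "W s = (\<Sum>j<m. (u s j)\<^sup>2)" using orth(2)[OF that that] by (simp add: power2_eq_square)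
    also have "\<dots> > 0" using m by (intro sum_pos2[of _ 0]) (auto simp: u_def)
    finally show ?thesis .
  qed
  have half_w: "half_op a (w s) j = s * u s j" if "j < m" for s j
  proof (cases j)
    case 0
    then show ?thesis using nz m by (simp add: half_op_def w_def u_def)
  next
    case (Suc i)
    have "a (Suc (2 * j)) \<noteq> 0" using nz that by auto
    from eigen_poly_recurrence[where a = a and k = "2 * j", OF this, of s] Suc show ?thesis
      by (simp add: half_op_def w_def u_def del: eigen_poly.simps)
  qed
  have half_sum: "half_op a (\<lambda>j. \<Sum>s\<in>S. c s * w s j) j = (\<Sum>s\<in>S. (c s * s) * u s j)"
    if "j < m" for c j
    using half_w[OF that] by (simp add: half_op_sum mult_ac)
  show ?thesis
  proof (rule that[OF finS cardS W])
    show "(\<Sum>j<m. (\<Sum>s\<in>S. c s * w s j)\<^sup>2) = (\<Sum>s\<in>S. (c s)\<^sup>2 * W s)" for c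
      by (rule sum_square_orthogonal_combination[OF finS orth(1)])
    have "(\<Sum>j<m. (half_op a (\<lambda>j. \<Sum>s\<in>S. c s * w s j) j)\<^sup>2) = (\<Sum>j<m. (\<Sum>s\<in>S. (c s * s) * u s j)\<^sup>2)" for c
      by (intro sum.cong refl) (simp add: half_sum)
    also have "\<dots> c = (\<Sum>s\<in>S. (c s * s)\<^sup>2 * W s)" for c
      by (rule sum_square_orthogonal_combination[OF finS orth(2)])
    finally show "(\<Sum>j<m. (half_op a (\<lambda>j. \<Sum>s\<in>S. c s * w s j) j)\<^sup>2) = (\<Sum>s\<in>S. s\<^sup>2 * (c s)\<^sup>2 * W s)" for c
      by (simp add: power_mult_distrib mult_ac)
  qed
qed

text \<open>The upper half of the min-max principle, for constraints that are zeros of \<open>x\<close>: if there were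
  more small singular values than constraints, some combination of their singular vectors would
  satisfy all constraints.\<close>
lemma card_small_singular_values_le:
  fixes a :: "nat \<Rightarrow> real"
  assumes nz: "\<forall>i\<in>{1..2 * m}. a i \<noteq> 0" and m: "m > 0" and lam: "lam > 0"
    and Z: "finite Z" "Z \<subseteq> {..<m}"
    and lower: "\<And>x. \<forall>j\<in>Z. x j = 0 \<Longrightarrow> lam\<^sup>2 * (\<Sum>j<m. (x j)\<^sup>2) \<le> (\<Sum>j<m. (half_op a x j)\<^sup>2)"
  shows "card {x. 0 < x \<and> x < lam \<and> poly (eigen_poly a (2 * m)) x = 0} \<le> card Z"
proof (rule ccontr)
  define S where "S = {x. 0 < x \<and> poly (eigen_poly a (2 * m)) x = 0}"
  define F where "F = {x. 0 < x \<and> x < lam \<and> poly (eigen_poly a (2 * m)) x = 0}"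
  obtain W w where S: "finite S" "card S = m" "\<And>s. s \<in> S \<Longrightarrow> W s > 0"
    and sq: "\<And>c. (\<Sum>j<m. (\<Sum>s\<in>S. c s * w s j)\<^sup>2) = (\<Sum>s\<in>S. (c s)\<^sup>2 * W s)"
    and half_sq: "\<And>c. (\<Sum>j<m. (half_op a (\<lambda>j. \<Sum>s\<in>S. c s * w s j) j)\<^sup>2) = (\<Sum>s\<in>S. s\<^sup>2 * (c s)\<^sup>2 * W s)"
    by (rule singular_value_expansion[OF nz m, folded S_def]) (rule that)
  have FS: "F \<subseteq> S" by (auto simp: F_def S_def)
  then have "finite F" using S(1) by (rule finite_subset)
  assume "\<not> card {x. 0 < x \<and> x < lam \<and> poly (eigen_poly a (2 * m)) x = 0} \<le> card Z"
  then have "card Z < card F" by (simp add: F_def)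
  then obtain c where c: "\<exists>s\<in>F. c s \<noteq> 0" "\<And>j. j \<in> Z \<Longrightarrow> (\<Sum>s\<in>F. c s * w s j) = 0"
    using homogeneous_system_nontrivial_solution[OF Z(1) \<open>finite F\<close>, of w] by blast
  define c' where "c' s = (if s \<in> F then c s else 0)" for s
  have "(\<Sum>s\<in>S. c' s * w s j) = (\<Sum>s\<in>F. c s * w s j)" for j
    using FS S(1) by (intro sum.mono_neutral_cong_right) (auto simp: c'_def)
  with c(2) have "\<forall>j\<in>Z. (\<Sum>s\<in>S. c' s * w s j) = 0" by simp
  then have "lam\<^sup>2 * (\<Sum>s\<in>S. (c' s)\<^sup>2 * W s) \<le> (\<Sum>s\<in>S. s\<^sup>2 * (c' s)\<^sup>2 * W s)"
    unfolding sq[symmetric] half_sq[symmetric] by (rule lower)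
  moreover have "(\<Sum>s\<in>S. s\<^sup>2 * (c' s)\<^sup>2 * W s) < lam\<^sup>2 * (\<Sum>s\<in>S. (c' s)\<^sup>2 * W s)"
    unfolding sum_distrib_left
  proof (rule sum_strict_mono_ex1[OF S(1)])
    show "\<forall>s\<in>S. s\<^sup>2 * (c' s)\<^sup>2 * W s \<le> lam\<^sup>2 * ((c' s)\<^sup>2 * W s)"
    proof
      fix s assume "s \<in> S"
      show "s\<^sup>2 * (c' s)\<^sup>2 * W s \<le> lam\<^sup>2 * ((c' s)\<^sup>2 * W s)"
      proof (cases "s \<in> F")
        case True
        then have "s\<^sup>2 \<le> lam\<^sup>2" by (intro power_mono) (auto simp: F_def)
        then show ?thesis unfolding mult.assoc
          using S(3)[OF \<open>s \<in> S\<close>] by (intro mult_right_mono) auto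
      qed (simp add: c'_def)
    qed
    from c(1) obtain s where s: "s \<in> F" "c s \<noteq> 0" by blast
    then have "s\<^sup>2 < lam\<^sup>2" by (intro power_strict_mono) (auto simp: F_def)
    moreover have "(c' s)\<^sup>2 * W s > 0" using s S(3)[of s] FS by (auto simp: c'_def)
    ultimately have "s\<^sup>2 * (c' s)\<^sup>2 * W s < lam\<^sup>2 * ((c' s)\<^sup>2 * W s)"
      unfolding mult.assoc by (intro mult_strict_right_mono)
    with s FS show "\<exists>s\<in>S. s\<^sup>2 * (c' s)\<^sup>2 * W s < lam\<^sup>2 * ((c' s)\<^sup>2 * W s)" by blast
  qed
  ultimately show False by simp
qed

text \<open>The lower half of the min-max principle. If the small singular values are fewer than the \<open>v r\<close>, then
  the \<open>v r\<close> and the singular vectors of the other singular values are together more than \<open>m\<close> vectors in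
  dimension \<open>m\<close>. A linear relation between them gives one vector for which both the strict upper bound
  from the \<open>v r\<close> and the lower bound from the singular values hold.\<close>
lemma card_small_singular_values_ge:
  fixes a :: "nat \<Rightarrow> real" and v :: "'r \<Rightarrow> nat \<Rightarrow> real"
  assumes nz: "\<forall>i\<in>{1..2 * m}. a i \<noteq> 0" and m: "m > 0" and lam: "lam > 0"
    and R: "finite R"
    and upper: "\<And>c. \<exists>r\<in>R. c r \<noteq> 0 \<Longrightarrow>
      (\<Sum>j<m. (half_op a (\<lambda>j. \<Sum>r\<in>R. c r * v r j) j)\<^sup>2) < lam\<^sup>2 * (\<Sum>j<m. (\<Sum>r\<in>R. c r * v r j)\<^sup>2)"
  shows "card R \<le> card {x. 0 < x \<and> x < lam \<and> poly (eigen_poly a (2 * m)) x = 0}"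
proof (rule ccontr)
  define S where "S = {x. 0 < x \<and> poly (eigen_poly a (2 * m)) x = 0}"
  define L where "L = {x. 0 < x \<and> x < lam \<and> poly (eigen_poly a (2 * m)) x = 0}"
  define G where "G = S - L"
  obtain W w where S: "finite S" "card S = m" "\<And>s. s \<in> S \<Longrightarrow> W s > 0"
    and sq: "\<And>c. (\<Sum>j<m. (\<Sum>s\<in>S. c s * w s j)\<^sup>2) = (\<Sum>s\<in>S. (c s)\<^sup>2 * W s)"
    and half_sq: "\<And>c. (\<Sum>j<m. (half_op a (\<lambda>j. \<Sum>s\<in>S. c s * w s j) j)\<^sup>2) = (\<Sum>s\<in>S. s\<^sup>2 * (c s)\<^sup>2 * W s)"
    by (rule singular_value_expansion[OF nz m, folded S_def]) (rule that)
  have "L \<subseteq> S" by (auto simp: L_def S_def)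
  then have G: "finite G" "card G = m - card L" "card L \<le> m" "G \<subseteq> S"
    using S by (auto simp: G_def card_Diff_subset finite_subset intro: card_mono)
  assume "\<not> card R \<le> card {x. 0 < x \<and> x < lam \<and> poly (eigen_poly a (2 * m)) x = 0}"
  then have "card {..<m} < card (R <+> G)"
    using R G by (simp add: L_def card_Plus)
  then obtain d where d: "\<exists>f\<in>R <+> G. d f \<noteq> 0"
    "\<And>j. j \<in> {..<m} \<Longrightarrow> (\<Sum>f\<in>R <+> G. d f * case_sum v w f j) = 0"
    using homogeneous_system_nontrivial_solution[of "{..<m}" "R <+> G" "case_sum v w"] R G by auto
  define c where "c r = d (Inl r)" for r
  define b where "b s = (if s \<in> G then - d (Inr s) else 0)" for s
  have eq: "(\<Sum>r\<in>R. c r * v r j) = (\<Sum>s\<in>S. b s * w s j)" if "j < m" for j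
  proof -
    have "(\<Sum>s\<in>S. b s * w s j) = - (\<Sum>s\<in>G. d (Inr s) * w s j)"
      unfolding sum_negf[symmetric] using G(4) S(1)
      by (intro sum.mono_neutral_cong_right) (auto simp: b_def)
    with d(2)[of j] that R G(1) show ?thesis by (simp add: sum.Plus c_def)
  qed
  have "half_op a (\<lambda>j. \<Sum>r\<in>R. c r * v r j) j = half_op a (\<lambda>j. \<Sum>s\<in>S. b s * w s j) j" if "j < m" for j
    using eq[of j] eq[of "j - 1"] that by (simp add: half_op_def)
  then have half: "(\<Sum>j<m. (half_op a (\<lambda>j. \<Sum>r\<in>R. c r * v r j) j)\<^sup>2) = (\<Sum>s\<in>S. s\<^sup>2 * (b s)\<^sup>2 * W s)"
    unfolding half_sq[symmetric] by (intro sum.cong) auto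
  have full: "(\<Sum>j<m. (\<Sum>r\<in>R. c r * v r j)\<^sup>2) = (\<Sum>s\<in>S. (b s)\<^sup>2 * W s)"
    unfolding sq[symmetric] using eq by (intro sum.cong) auto
  have "lam\<^sup>2 * (\<Sum>s\<in>S. (b s)\<^sup>2 * W s) \<le> (\<Sum>s\<in>S. s\<^sup>2 * (b s)\<^sup>2 * W s)"
    unfolding sum_distrib_left
  proof (rule sum_mono)
    fix s assume "s \<in> S"
    show "lam\<^sup>2 * ((b s)\<^sup>2 * W s) \<le> s\<^sup>2 * (b s)\<^sup>2 * W s"
    proof (cases "s \<in> G")
      case True
      then have "lam\<^sup>2 \<le> s\<^sup>2" using lam by (intro power_mono) (auto simp: G_def S_def L_def)
      then show ?thesis unfolding mult.assoc
        using S(3)[OF \<open>s \<in> S\<close>] by (intro mult_right_mono) auto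
    qed (simp add: b_def)
  qed
  with half full have "\<not> (\<exists>r\<in>R. c r \<noteq> 0)" using upper[of c] by auto
  then have c0: "\<forall>r\<in>R. c r = 0" by blast
  with full have "(\<Sum>s\<in>S. (b s)\<^sup>2 * W s) = 0" by simp
  moreover have nonneg: "0 \<le> (b s)\<^sup>2 * W s" if "s \<in> S" for s
    using S(3)[OF that] by simp
  ultimately have "\<forall>s\<in>S. (b s)\<^sup>2 * W s = 0"
    using S(1) nonneg by (subst (asm) sum_nonneg_eq_0_iff) auto
  then have "\<forall>s\<in>G. d (Inr s) = 0" using G(4) S(3) by (fastforce simp: b_def)
  with c0 d(1) show False by (auto simp: c_def)
qed

section \<open>The zero mode and the process\<close>

text \<open>The solution of \<open>A x = 0\<close> outside the first row is \<open>zero_mode a j / a (2 * j + 1)\<close>. The weight is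
  kept apart because only the factor \<open>zero_mode a j\<close> is the exponential of the process.\<close>
definition zero_mode :: "(nat \<Rightarrow> real) \<Rightarrow> nat \<Rightarrow> real" where
  "zero_mode a k = (\<Prod>i = 1..k. - (a (2 * i) / a (2 * i - 1)))"

lemma abs_zero_mode:
  assumes "\<forall>i\<in>{1..2 * k}. a i \<noteq> 0"
  shows "\<bar>zero_mode a k\<bar> = exp (- log_ratio_process a k)"
proof -
  have "exp (- log_ratio_process a k) = (\<Prod>i = 1..k. exp (- ln \<bar>a (2 * i - 1) / a (2 * i)\<bar>))"
    by (simp add: log_ratio_process_def exp_sum flip: sum_negf)
  also have "\<dots> = (\<Prod>i = 1..k. \<bar>a (2 * i) / a (2 * i - 1)\<bar>)"
  proof (intro prod.cong refl)
    fix i assume "i \<in> {1..k}"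
    then have "1 \<le> i" "i \<le> k" by auto
    then have "2 * i \<in> {1..2 * k}" "2 * i - 1 \<in> {1..2 * k}"
      unfolding atLeastAtMost_iff by linarith+
    then have "a (2 * i) \<noteq> 0" "a (2 * i - 1) \<noteq> 0" using assms by blast+
    then show "exp (- ln \<bar>a (2 * i - 1) / a (2 * i)\<bar>) = \<bar>a (2 * i) / a (2 * i - 1)\<bar>"
      by (simp add: exp_minus abs_divide)
  qed
  also have "\<dots> = \<bar>zero_mode a k\<bar>"
    by (simp add: zero_mode_def abs_prod)
  finally show ?thesis ..
qed

lemma half_op_zero_mode_mult:
  assumes "\<forall>i\<in>{1..2 * m}. a i \<noteq> 0" "j < m"
  shows "half_op a (\<lambda>j. zero_mode a j / a (2 * j + 1) * \<xi> j) j =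
    zero_mode a j * (\<xi> j - (if j = 0 then 0 else \<xi> (j - 1)))"
proof (cases j)
  case 0
  have "a (Suc 0) \<noteq> 0" using assms by auto
  with 0 show ?thesis by (simp add: half_op_def zero_mode_def)
next
  case (Suc i)
  have "a (2 * j + 1) \<noteq> 0" "a (2 * i + 1) \<noteq> 0" using assms Suc by auto
  then have "half_op a (\<lambda>j. zero_mode a j / a (2 * j + 1) * \<xi> j) j =
      zero_mode a j * \<xi> j + a (2 * j) / a (2 * i + 1) * zero_mode a i * \<xi> i"
    by (simp add: half_op_def Suc)
  also have "a (2 * j) / a (2 * i + 1) * zero_mode a i = - zero_mode a j"
    by (simp add: zero_mode_def Suc)
  finally show ?thesis using Suc by (simp add: algebra_simps)
qed

text \<open>The reconstruction of \<open>x\<close> from \<open>A x\<close>. At a barrier \<open>\<xi>\<close> vanishes, so \<open>\<xi> j\<close> is plus or minus the sum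
  of the differences \<open>(A x) k / h k\<close> between \<open>j\<close> and the barrier. After multiplication by \<open>h j\<close>
  the coefficients have modulus \<open>exp (X k - X j) < exp \<alpha>\<close>.\<close>
lemma half_op_lower_bound:
  assumes nz: "\<forall>i\<in>{1..2 * m}. a i \<noteq> 0"
    and X: "\<And>k. k < m \<Longrightarrow> \<bar>zero_mode a k\<bar> = exp (- X k)"
    and Z: "Z \<subseteq> {..<m}" "\<forall>j\<in>Z. x j = 0"
    and barrier: "\<And>j. j < m \<Longrightarrow>
       (\<exists>c\<le>j. (c = 0 \<or> c - 1 \<in> Z) \<and> (\<forall>k\<in>{c..j}. X k - X j < \<alpha>)) \<or>
       (\<exists>e\<ge>j. e \<in> Z \<and> (\<forall>k\<in>{j<..e}. X k - X j < \<alpha>))"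
    and \<beta>: "\<beta> > 0" "\<And>j. j < m \<Longrightarrow> j \<notin> Z \<Longrightarrow> \<beta> \<le> \<bar>a (2 * j + 1)\<bar>"
  shows "(\<Sum>j<m. (x j)\<^sup>2) \<le> (real m * exp \<alpha> / \<beta>)\<^sup>2 * (\<Sum>j<m. (half_op a x j)\<^sup>2)"
proof -
  define h where "h = zero_mode a"
  define y where "y = half_op a x"
  define \<xi> where "\<xi> j = x j * a (2 * j + 1) / h j" for j
  \<comment> \<open>The shift of \<open>\<xi>\<close> by one, so that the left end of the time set acts as a barrier at \<open>-1\<close>.\<close>
  define \<Xi> where "\<Xi> k = (if k = 0 then 0 else \<xi> (k - 1))" for k
  have h: "\<bar>h k\<bar> = exp (- X k)" "h k \<noteq> 0" if "k < m" for k
  proof -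
    show "\<bar>h k\<bar> = exp (- X k)" using X[OF that] by (simp add: h_def)
    then show "h k \<noteq> 0" by (metis abs_zero exp_not_eq_zero)
  qed
  have x_eq: "x j = h j / a (2 * j + 1) * \<xi> j" if "j < m" for j
    using h(2)[OF that] nz that by (simp add: \<xi>_def)
  have y_eq: "y k / h k = \<Xi> (Suc k) - \<Xi> k" if "k < m" for k
  proof -
    have "y k = half_op a (\<lambda>j. zero_mode a j / a (2 * j + 1) * \<xi> j) k"
      using x_eq[of k] x_eq[of "k - 1"] that by (simp add: y_def half_op_def h_def)
    also have "\<dots> = h k * (\<Xi> (Suc k) - \<Xi> k)"
      unfolding half_op_zero_mode_mult[OF nz that] by (simp add: h_def \<Xi>_def)
    finally show ?thesis using h(2)[OF that] by simp
  qed
  define T where "T = (\<Sum>k<m. \<bar>y k\<bar>)"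
  have bound: "\<bar>x j\<bar> \<le> exp \<alpha> / \<beta> * T" if "j < m" for j
  proof (cases "j \<in> Z")
    case True
    then show ?thesis using Z \<beta>(1) by (simp add: T_def sum_nonneg)
  next
    case False
    have "\<exists>K\<subseteq>{..<m}. \<bar>\<xi> j\<bar> = \<bar>\<Sum>k\<in>K. y k / h k\<bar> \<and> (\<forall>k\<in>K. X k - X j < \<alpha>)"
      using barrier[OF that]
    proof
      assume "\<exists>c\<le>j. (c = 0 \<or> c - 1 \<in> Z) \<and> (\<forall>k\<in>{c..j}. X k - X j < \<alpha>)"
      then obtain c where c: "c \<le> j" "c = 0 \<or> c - 1 \<in> Z" "\<forall>k\<in>{c..j}. X k - X j < \<alpha>" by blast
      have "(\<Sum>k = c..<Suc j. y k / h k) = (\<Sum>k = c..<Suc j. \<Xi> (Suc k) - \<Xi> k)"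
        using that by (intro sum.cong) (auto simp: y_eq)
      also have "\<dots> = \<Xi> (Suc j) - \<Xi> c" using c(1) by (intro sum_Suc_diff') auto
      also have "\<Xi> c = 0" using c(2) Z by (auto simp: \<Xi>_def \<xi>_def)
      finally have "\<xi> j = (\<Sum>k = c..<Suc j. y k / h k)" by (simp add: \<Xi>_def)
      with c(3) that show ?thesis by (intro exI[of _ "{c..<Suc j}"]) auto
    next
      assume "\<exists>e\<ge>j. e \<in> Z \<and> (\<forall>k\<in>{j<..e}. X k - X j < \<alpha>)"
      then obtain e where e: "j \<le> e" "e \<in> Z" "\<forall>k\<in>{j<..e}. X k - X j < \<alpha>" by blast
      then have "e < m" using Z by auto
      then have "(\<Sum>k = Suc j..<Suc e. y k / h k) = (\<Sum>k = Suc j..<Suc e. \<Xi> (Suc k) - \<Xi> k)"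
        by (intro sum.cong) (auto simp: y_eq)
      also have "\<dots> = \<Xi> (Suc e) - \<Xi> (Suc j)" using e(1) by (intro sum_Suc_diff') auto
      also have "\<Xi> (Suc e) = 0" using e(2) Z by (auto simp: \<Xi>_def \<xi>_def)
      finally have "\<xi> j = - (\<Sum>k = Suc j..<Suc e. y k / h k)" by (simp add: \<Xi>_def)
      with e(3) \<open>e < m\<close> show ?thesis by (intro exI[of _ "{Suc j..<Suc e}"]) auto
    qed
    then obtain K where K: "K \<subseteq> {..<m}" "\<bar>\<xi> j\<bar> = \<bar>\<Sum>k\<in>K. y k / h k\<bar>" "\<forall>k\<in>K. X k - X j < \<alpha>"
      by blast
    have "\<bar>h j\<bar> * \<bar>\<xi> j\<bar> \<le> \<bar>h j\<bar> * (\<Sum>k\<in>K. \<bar>y k / h k\<bar>)"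
      unfolding K(2) by (intro mult_left_mono sum_abs) auto
    also have "\<dots> = (\<Sum>k\<in>K. exp (X k - X j) * \<bar>y k\<bar>)"
      unfolding sum_distrib_left
    proof (intro sum.cong refl)
      fix k assume "k \<in> K"
      then show "\<bar>h j\<bar> * \<bar>y k / h k\<bar> = exp (X k - X j) * \<bar>y k\<bar>"
        using K(1) that by (auto simp: abs_divide h exp_diff exp_minus field_simps)
    qed
    also have "\<dots> \<le> (\<Sum>k\<in>K. exp \<alpha> * \<bar>y k\<bar>)"
      using K(3) by (intro sum_mono mult_right_mono) (auto intro: less_imp_le)
    also have "\<dots> \<le> (\<Sum>k<m. exp \<alpha> * \<bar>y k\<bar>)"
      using K(1) by (intro sum_mono2) auto
    finally have *: "\<bar>h j\<bar> * \<bar>\<xi> j\<bar> \<le> exp \<alpha> * T" by (simp add: T_def sum_distrib_left)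
    have "\<bar>x j\<bar> = \<bar>h j\<bar> * \<bar>\<xi> j\<bar> / \<bar>a (2 * j + 1)\<bar>"
      unfolding x_eq[OF that] by (simp add: abs_mult)
    also have "\<dots> \<le> exp \<alpha> * T / \<beta>"
      using * \<beta>(1) \<beta>(2)[OF that False] by (intro frac_le) (auto simp: T_def intro: sum_nonneg)
    finally show ?thesis by simp
  qed
  have "(\<Sum>j<m. (x j)\<^sup>2) \<le> (\<Sum>j<m. (exp \<alpha> / \<beta> * T)\<^sup>2)"
    using bound by (intro sum_mono) (metis abs_ge_zero lessThan_iff power2_abs power_mono)
  also have "\<dots> = real m * (exp \<alpha> / \<beta>)\<^sup>2 * T\<^sup>2" by (simp add: power_mult_distrib power_divide)
  also have "\<dots> \<le> real m * (exp \<alpha> / \<beta>)\<^sup>2 * ((\<Sum>k<m. (y k)\<^sup>2) * real m)"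
    using sum_squared_le_sum_of_squares[of "\<lambda>k. \<bar>y k\<bar>" "{..<m}"]
    by (intro mult_left_mono) (auto simp: T_def)
  also have "\<dots> = (real m * exp \<alpha> / \<beta>)\<^sup>2 * (\<Sum>j<m. (half_op a x j)\<^sup>2)"
    by (simp add: y_def power2_eq_square)
  finally show ?thesis .
qed

text \<open>The test functions are the zero mode cut off to the valleys \<open>{i r..<e r}\<close>; if \<open>e r = m\<close>, the
  valley extends to the right end, where no row is left to be violated. The image of each lives on the two
  edges, where it has size \<open>exp (- X (i r))\<close> and \<open>exp (- X (e r))\<close>, while at the bottom the test
  function itself is at least \<open>exp (- X (l r)) / \<gamma>\<close>. Neighbouring valleys may share an edge, hence
  the Cauchy-Schwarz factor \<open>card R\<close>.\<close>
lemma half_op_test_functions: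
  fixes i l e :: "nat \<Rightarrow> nat" and c :: "nat \<Rightarrow> real"
  assumes nz: "\<forall>i\<in>{1..2 * m}. a i \<noteq> 0"
    and X: "\<And>k. k < m \<Longrightarrow> \<bar>zero_mode a k\<bar> = exp (- X k)"
    and R: "finite R"
    and valley: "\<And>r. r \<in> R \<Longrightarrow> i r \<le> l r \<and> l r < e r \<and> l r < m \<and> X (i r) - X (l r) \<ge> \<alpha> \<and>
       (e r < m \<longrightarrow> X (e r) - X (l r) \<ge> \<alpha>)"
    and disjoint: "\<And>r r'. r \<in> R \<Longrightarrow> r' \<in> R \<Longrightarrow> r < r' \<Longrightarrow> e r \<le> i r'"
    and \<gamma>: "\<And>r. r \<in> R \<Longrightarrow> \<bar>a (2 * l r + 1)\<bar> \<le> \<gamma>"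
  defines "x \<equiv> \<lambda>j. \<Sum>r\<in>R. c r * (zero_mode a j / a (2 * j + 1) * of_bool (j \<in> {i r..<e r}))"
  shows "(\<Sum>j<m. (half_op a x j)\<^sup>2) \<le> 2 * card R * (\<gamma> / exp \<alpha>)\<^sup>2 * (\<Sum>j<m. (x j)\<^sup>2)"
    and "\<exists>r\<in>R. c r \<noteq> 0 \<Longrightarrow> 0 < (\<Sum>j<m. (x j)\<^sup>2)"
proof -
  define h where "h = zero_mode a"
  define v where "v r j = h j / a (2 * j + 1) * of_bool (j \<in> {i r..<e r})" for r j
  define E where "E r = exp (- X (l r))" for r
  have x_def': "x = (\<lambda>j. \<Sum>r\<in>R. c r * v r j)" by (simp add: x_def v_def h_def)
  have h: "(h k)\<^sup>2 = (exp (- X k))\<^sup>2" if "k < m" for k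
    using X[OF that] by (metis h_def power2_abs)
  have outside: "l r \<notin> {i r'..<e r'}" if "r \<in> R" "r' \<in> R" "r \<noteq> r'" for r r'
  proof (cases "r < r'")
    case True
    then show ?thesis using disjoint[OF that(1,2)] valley[OF that(1)] by auto
  next
    case False
    then show ?thesis using disjoint[OF that(2,1)] valley[OF that(1)] that by auto
  qed
  have inj: "inj_on l R"
  proof (rule inj_onI, rule ccontr)
    fix r r' assume "r \<in> R" "r' \<in> R" "l r = l r'" "r \<noteq> r'"
    with outside[of r r'] valley[of r'] show False by auto
  qed
  have x_l: "x (l r) = c r * (h (l r) / a (2 * l r + 1))" if "r \<in> R" for r
  proof -
    have "x (l r) = (\<Sum>r'\<in>R. if r' = r then c r * v r (l r) else 0)"
      unfolding x_def' using outside[OF that] by (intro sum.cong) (auto simp: v_def)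
    also have "\<dots> = c r * v r (l r)" using R that by (simp add: sum.delta)
    finally show ?thesis using valley[OF that] by (simp add: v_def)
  qed
  have x_sq: "(\<Sum>r\<in>R. (x (l r))\<^sup>2) \<le> (\<Sum>j<m. (x j)\<^sup>2)"
  proof -
    have "(\<Sum>r\<in>R. (x (l r))\<^sup>2) = (\<Sum>j\<in>l ` R. (x j)\<^sup>2)"
      using inj by (simp add: sum.reindex)
    also have "\<dots> \<le> (\<Sum>j<m. (x j)\<^sup>2)"
      using valley by (intro sum_mono2) auto
    finally show ?thesis .
  qed
  have x_l_sq: "(c r)\<^sup>2 * (E r)\<^sup>2 \<le> \<gamma>\<^sup>2 * (x (l r))\<^sup>2" if "r \<in> R" for r
  proof -
    have nz_l: "a (2 * l r + 1) \<noteq> 0" using nz valley[OF that] by auto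
    have "(c r)\<^sup>2 * (E r)\<^sup>2 = (a (2 * l r + 1))\<^sup>2 * (x (l r))\<^sup>2"
      using h[of "l r"] valley[OF that] nz_l
      by (simp add: x_l[OF that] E_def power_mult_distrib power_divide)
    also have "\<dots> \<le> \<gamma>\<^sup>2 * (x (l r))\<^sup>2"
      using power_mono[OF \<gamma>[OF that], of 2] by (intro mult_right_mono) auto
    finally show ?thesis .
  qed
  have v_sq: "(\<Sum>j<m. (half_op a (v r) j)\<^sup>2) \<le> 2 * (E r / exp \<alpha>)\<^sup>2" if "r \<in> R" for r
  proof -
    have "(\<Sum>j<m. (half_op a (v r) j)\<^sup>2) \<le>
        (\<Sum>j<m. (if j = i r then (h j)\<^sup>2 else 0) + (if j = e r then (h j)\<^sup>2 else 0))"
    proof (rule sum_mono)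
      fix j assume "j \<in> {..<m}"
      then have j: "j < m" by simp
      have "v r = (\<lambda>j. zero_mode a j / a (2 * j + 1) * of_bool (j \<in> {i r..<e r}))"
        by (simp add: v_def h_def fun_eq_iff)
      then have "half_op a (v r) j = h j * (of_bool (j \<in> {i r..<e r}) -
          (if j = 0 then 0 else of_bool (j - 1 \<in> {i r..<e r})))"
        using half_op_zero_mode_mult[OF nz j, of "\<lambda>j. of_bool (j \<in> {i r..<e r})"]
        unfolding h_def by simp
      then show "(half_op a (v r) j)\<^sup>2 \<le>
          (if j = i r then (h j)\<^sup>2 else 0) + (if j = e r then (h j)\<^sup>2 else 0)"
        using valley[OF that] by auto
    qed
    also have "\<dots> = (if i r < m then (h (i r))\<^sup>2 else 0) + (if e r < m then (h (e r))\<^sup>2 else 0)"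
      by (simp add: sum.distrib)
    also have "\<dots> \<le> (E r / exp \<alpha>)\<^sup>2 + (E r / exp \<alpha>)\<^sup>2"
    proof -
      have "(h k)\<^sup>2 \<le> (E r / exp \<alpha>)\<^sup>2" if "k < m" "X k - X (l r) \<ge> \<alpha>" for k
        unfolding h[OF that(1)] E_def exp_diff[symmetric] using that(2) by (intro power_mono) auto
      then show ?thesis using valley[OF that] by (intro add_mono) auto
    qed
    finally show ?thesis by simp
  qed
  have "(\<Sum>j<m. (half_op a x j)\<^sup>2) = (\<Sum>j<m. (\<Sum>r\<in>R. c r * half_op a (v r) j)\<^sup>2)"
    by (simp add: x_def' half_op_sum)
  also have "\<dots> \<le> (\<Sum>j<m. (\<Sum>r\<in>R. (c r * half_op a (v r) j)\<^sup>2) * card R)"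
    by (intro sum_mono sum_squared_le_sum_of_squares)
  also have "\<dots> = card R * (\<Sum>j<m. \<Sum>r\<in>R. (c r)\<^sup>2 * (half_op a (v r) j)\<^sup>2)"
    by (simp add: sum_distrib_left power_mult_distrib mult.commute)
  also have "(\<Sum>j<m. \<Sum>r\<in>R. (c r)\<^sup>2 * (half_op a (v r) j)\<^sup>2) =
      (\<Sum>r\<in>R. (c r)\<^sup>2 * (\<Sum>j<m. (half_op a (v r) j)\<^sup>2))"
    unfolding sum_distrib_left by (rule sum.swap)
  also have "card R * \<dots> \<le> card R * (\<Sum>r\<in>R. (c r)\<^sup>2 * (2 * (E r / exp \<alpha>)\<^sup>2))"
    by (intro mult_left_mono sum_mono v_sq) auto
  also have "\<dots> = 2 * card R / (exp \<alpha>)\<^sup>2 * (\<Sum>r\<in>R. (c r)\<^sup>2 * (E r)\<^sup>2)"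
    by (simp add: sum_distrib_left power_divide mult_ac)
  also have "\<dots> \<le> 2 * card R / (exp \<alpha>)\<^sup>2 * (\<Sum>r\<in>R. \<gamma>\<^sup>2 * (x (l r))\<^sup>2)"
    by (intro mult_left_mono sum_mono x_l_sq) auto
  also have "\<dots> = 2 * card R * (\<gamma> / exp \<alpha>)\<^sup>2 * (\<Sum>r\<in>R. (x (l r))\<^sup>2)"
    by (simp add: sum_distrib_left sum_divide_distrib power_divide mult_ac)
  also have "\<dots> \<le> 2 * card R * (\<gamma> / exp \<alpha>)\<^sup>2 * (\<Sum>j<m. (x j)\<^sup>2)"
    by (intro mult_left_mono x_sq) auto
  finally show "(\<Sum>j<m. (half_op a x j)\<^sup>2) \<le> 2 * card R * (\<gamma> / exp \<alpha>)\<^sup>2 * (\<Sum>j<m. (x j)\<^sup>2)" .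
  show "0 < (\<Sum>j<m. (x j)\<^sup>2)" if "\<exists>r\<in>R. c r \<noteq> 0"
  proof -
    from that obtain r where r: "r \<in> R" "c r \<noteq> 0" by blast
    then have "0 < (c r)\<^sup>2 * (E r)\<^sup>2" by (simp add: E_def)
    with x_l_sq[OF r(1)] have "x (l r) \<noteq> 0" by auto
    then have "0 < (\<Sum>r\<in>R. (x (l r))\<^sup>2)"
      using R r(1) by (intro sum_pos2[of _ r]) auto
    with x_sq show ?thesis by simp
  qed
qed

section \<open>The number of small eigenvalues\<close>

theorem proposition1p2:
  fixes n :: nat and a :: "nat \<Rightarrow> real" and \<delta> lam :: real
  assumes "odd n"
    and "\<And>k. k \<in> {1..n} \<Longrightarrow> a k \<noteq> 0"
    and "0 < \<delta>" and "\<delta> < 1"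
    and "0 < lam" and "lam < (\<delta> / (16 * real n)) powr (2 / \<delta>)"
  shows "let M = num_eigenvalues_in (schroedinger_mat n a) {0<..<lam};
             D = (\<lambda>c. num_downcrossings ((n - 1) div 2) (log_ratio_process a) (c * \<bar>ln lam\<bar>));
             B = card {k \<in> {1..n}. \<bar>ln \<bar>a k\<bar>\<bar> > \<delta> / 8 * \<bar>ln lam\<bar>}
         in int (D (1 + \<delta>)) - 2 * int B \<le> int M \<and> int M \<le> int (D (1 - \<delta>)) + 2 * int B"
proof -
  define N where "N = (n - 1) div 2"
  define m where "m = Suc N"
  define X where "X = log_ratio_process a"
  define L where "L = \<bar>ln lam\<bar>"
  define bad where "bad = {k \<in> {1..n}. \<bar>ln \<bar>a k\<bar>\<bar> > \<delta> / 8 * L}"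
  define D where "D c = num_downcrossings N X (c * L)" for c
  have n: "n = 2 * N + 1" using \<open>odd n\<close> by (auto simp: N_def elim: oddE)
  have n_pos: "real n > 0" using n by simp
  have "finite bad" by (simp add: bad_def)

  have lam_small: "real n * lam powr (\<delta> / 2) < 1 / 16" and "lam < 1"
  proof -
    have "lam powr (\<delta> / 2) < ((\<delta> / (16 * real n)) powr (2 / \<delta>)) powr (\<delta> / 2)"
      using assms by (intro powr_less_mono2) auto
    also have "\<dots> = \<delta> / (16 * real n)" using assms n_pos by (simp add: powr_powr)
    finally show "real n * lam powr (\<delta> / 2) < 1 / 16"
      using n_pos \<open>\<delta> < 1\<close> by (simp add: field_simps)
    have "\<delta> / (16 * real n) < 1" using n \<open>\<delta> < 1\<close> by (simp add: field_simps)
    then have "(\<delta> / (16 * real n)) powr (2 / \<delta>) \<le> 1"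
      using assms n_pos by (intro powr_le1) auto
    with assms(6) show "lam < 1" by simp
  qed
  have L: "L > 0" "lam = exp (- L)" using \<open>0 < lam\<close> \<open>lam < 1\<close> by (simp_all add: L_def)
  have small: "real n * exp (- t) < 1 / 16" if "\<delta> / 2 * L \<le> t" for t
  proof -
    have "real n * exp (- t) \<le> real n * exp (- (\<delta> / 2 * L))" using that by (intro mult_left_mono) auto
    also have "exp (- (\<delta> / 2 * L)) = lam powr (\<delta> / 2)" by (simp add: powr_def L(2))
    finally show ?thesis using lam_small by simp
  qed

  \<comment> \<open>The weight with index \<open>n + 1\<close> does not occur in the matrix. Giving it a nonzero value lets the
     recursion for the eigenvectors run one step past the last row.\<close>
  define b where "b = a(2 * m := 1)"
  have b_eq: "b k = a k" if "k \<le> n" for k using that by (simp add: b_def n m_def)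
  have nz: "\<forall>i\<in>{1..2 * m}. b i \<noteq> 0" using assms(2) by (auto simp: b_def m_def n)
  have X: "\<bar>zero_mode b k\<bar> = exp (- X k)" if "k < m" for k
  proof -
    have "zero_mode b k = zero_mode a k"
      unfolding zero_mode_def using that by (intro prod.cong) (auto simp: b_eq n m_def)
    moreover have "\<forall>i\<in>{1..2 * k}. a i \<noteq> 0" using that assms(2) by (auto simp: n m_def)
    ultimately show ?thesis by (simp add: abs_zero_mode X_def)
  qed
  define M where "M = card {x. 0 < x \<and> x < lam \<and> poly (eigen_poly b (2 * m)) x = 0}"
  have "schroedinger_mat n a = schroedinger_mat n b"
    by (rule eq_matI) (auto simp: schroedinger_mat_def b_eq)
  moreover have "eigenvalue (schroedinger_mat n b) x \<longleftrightarrow> poly (eigen_poly b (2 * m)) x = 0" for x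
    using eigenvalue_schroedinger_mat_iff[of n b x] nz by (simp add: n m_def del: eigen_poly.simps)
  ultimately have M: "num_eigenvalues_in (schroedinger_mat n a) {0<..<lam} = M"
    by (simp add: num_eigenvalues_in_def M_def conj_assoc del: eigen_poly.simps)
  have good: "exp (- (\<delta> / 8 * L)) \<le> \<bar>b (2 * j + 1)\<bar>" "\<bar>b (2 * j + 1)\<bar> \<le> exp (\<delta> / 8 * L)"
    if "j < m" "2 * j + 1 \<notin> bad" for j
  proof -
    have "b (2 * j + 1) = a (2 * j + 1)" using that by (intro b_eq) (simp add: n m_def)
    moreover have "\<bar>b (2 * j + 1)\<bar> > 0" using nz that by auto
    moreover have "\<bar>ln \<bar>a (2 * j + 1)\<bar>\<bar> \<le> \<delta> / 8 * L"
      using that by (auto simp: bad_def n m_def not_less)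
    then have "exp (- (\<delta> / 8 * L)) \<le> exp (ln \<bar>a (2 * j + 1)\<bar>)"
      "exp (ln \<bar>a (2 * j + 1)\<bar>) \<le> exp (\<delta> / 8 * L)" by auto
    ultimately show "exp (- (\<delta> / 8 * L)) \<le> \<bar>b (2 * j + 1)\<bar>" "\<bar>b (2 * j + 1)\<bar> \<le> exp (\<delta> / 8 * L)"
      by simp_all
  qed

  have "M \<le> D (1 - \<delta>) + card bad"
  proof -
    have pos: "0 < (1 - \<delta>) * L" using L \<open>\<delta> < 1\<close> by simp
    obtain Z where Z: "Z \<subseteq> {..N}" "card Z \<le> D (1 - \<delta>)" and
      barrier: "\<And>j. j \<le> N \<Longrightarrow>
       (\<exists>c\<le>j. (c = 0 \<or> c - 1 \<in> Z) \<and> (\<forall>k\<in>{c..j}. X k - X j < (1 - \<delta>) * L)) \<or>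
       (\<exists>e\<ge>j. e \<in> Z \<and> (\<forall>k\<in>{j<..e}. X k - X j < (1 - \<delta>) * L))"
      by (rule downcrossing_barriers[where N = N and X = X, OF pos, folded D_def]) (rule that)
    \<comment> \<open>Where the weight may be too small, a further constraint \<open>x j = 0\<close> takes the place of the bound.\<close>
    define Z' where "Z' = Z \<union> {j. j < m \<and> 2 * j + 1 \<in> bad}"
    have "card {j. j < m \<and> 2 * j + 1 \<in> bad} \<le> card bad"
      using \<open>finite bad\<close> by (intro card_inj_on_le[of "\<lambda>j. 2 * j + 1"]) (auto intro: inj_onI)
    then have card_Z': "card Z' \<le> D (1 - \<delta>) + card bad"
      using card_Un_le[of Z "{j. j < m \<and> 2 * j + 1 \<in> bad}"] Z(2) by (simp add: Z'_def)
    have Z': "Z' \<subseteq> {..<m}" using Z(1) by (auto simp: Z'_def m_def)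
    have "M \<le> card Z'"
      unfolding M_def
    proof (rule card_small_singular_values_le[OF nz _ \<open>0 < lam\<close> _ Z'])
      show "finite Z'" using Z' finite_subset by blast
      fix x :: "nat \<Rightarrow> real" assume x: "\<forall>j\<in>Z'. x j = 0"
      define q where "q = real m * exp ((1 - \<delta>) * L) / exp (- (\<delta> / 8 * L))"
      have "(\<Sum>j<m. (x j)\<^sup>2) \<le> q\<^sup>2 * (\<Sum>j<m. (half_op b x j)\<^sup>2)"
        unfolding q_def
      proof (rule half_op_lower_bound[OF nz X Z' x])
        fix j assume "j < m"
        then show "(\<exists>c\<le>j. (c = 0 \<or> c - 1 \<in> Z') \<and> (\<forall>k\<in>{c..j}. X k - X j < (1 - \<delta>) * L)) \<or>
            (\<exists>e\<ge>j. e \<in> Z' \<and> (\<forall>k\<in>{j<..e}. X k - X j < (1 - \<delta>) * L))"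
          using barrier[of j] unfolding Z'_def m_def by auto
      qed (use good in \<open>auto simp: Z'_def\<close>)
      then have "lam\<^sup>2 * (\<Sum>j<m. (x j)\<^sup>2) \<le> lam\<^sup>2 * (q\<^sup>2 * (\<Sum>j<m. (half_op b x j)\<^sup>2))"
        by (intro mult_left_mono) auto
      also have "\<dots> = (lam * q)\<^sup>2 * (\<Sum>j<m. (half_op b x j)\<^sup>2)"
        by (simp add: power_mult_distrib)
      also have "\<dots> \<le> 1\<^sup>2 * (\<Sum>j<m. (half_op b x j)\<^sup>2)"
      proof (intro mult_right_mono power_mono sum_nonneg)
        have "lam * q = real m * exp (- (7 / 8 * \<delta> * L))"
          unfolding q_def L(2) by (simp add: field_simps flip: exp_add exp_diff)
        also have "\<dots> \<le> real n * exp (- (7 / 8 * \<delta> * L))"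
          by (intro mult_right_mono) (auto simp: n m_def)
        also have "\<dots> \<le> 1" using small[of "7 / 8 * \<delta> * L"] L(1) \<open>0 < \<delta>\<close> by simp
        finally show "lam * q \<le> 1" .
      qed (use \<open>0 < lam\<close> in \<open>auto simp: q_def\<close>)
      finally show "lam\<^sup>2 * (\<Sum>j<m. (x j)\<^sup>2) \<le> (\<Sum>j<m. (half_op b x j)\<^sup>2)" by simp
    qed (simp add: m_def)
    with card_Z' show ?thesis by simp
  qed
  moreover have "D (1 + \<delta>) \<le> M + card bad"
  proof -
    have pos: "0 < (1 + \<delta>) * L" using L \<open>0 < \<delta>\<close> by simp
    obtain i l e where valley: "\<And>r. r < D (1 + \<delta>) \<Longrightarrow>
       i r \<le> l r \<and> l r < e r \<and> l r \<le> N \<and> X (i r) - X (l r) \<ge> (1 + \<delta>) * L \<and>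
       (e r \<le> N \<longrightarrow> X (e r) - X (l r) \<ge> (1 + \<delta>) * L)"
      and disjoint: "\<And>r r'. r < r' \<Longrightarrow> r' < D (1 + \<delta>) \<Longrightarrow> e r \<le> i r'"
      by (rule downcrossing_valleys[where N = N and X = X, OF pos, folded D_def]) (rule that)
    have mono: "l r < l r'" if "r < r'" "r' < D (1 + \<delta>)" for r r'
      using disjoint[OF that] valley[of r] valley[of r'] that by auto
    have inj: "inj_on l {..<D (1 + \<delta>)}"
      using mono by (auto intro!: linorder_inj_onI' simp: less_imp_neq)
    \<comment> \<open>The test function is compared with the weight at the bottom of its valley, and different valleys
       have different bottoms, so that a bad weight spoils at most one test function.\<close>
    define R where "R = {r. r < D (1 + \<delta>) \<and> 2 * l r + 1 \<notin> bad}"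
    have "finite R" by (simp add: R_def)
    have "card ({..<D (1 + \<delta>)} - R) \<le> card bad"
    proof (rule card_inj_on_le[of "\<lambda>r. 2 * l r + 1"])
      show "inj_on (\<lambda>r. 2 * l r + 1) ({..<D (1 + \<delta>)} - R)"
        using inj by (auto simp: inj_on_def)
    qed (use \<open>finite bad\<close> in \<open>auto simp: R_def\<close>)
    moreover have R_sub: "R \<subseteq> {..<D (1 + \<delta>)}" by (auto simp: R_def)
    ultimately have card_R: "D (1 + \<delta>) \<le> card R + card bad"
      using \<open>finite R\<close> by (simp add: card_Diff_subset)
    have "R \<subseteq> {r. l r < m \<and> r < D (1 + \<delta>)}" using valley by (auto simp: R_def m_def less_Suc_eq_le)
    then have "card R \<le> card {..<m}"
      using inj by (intro card_inj_on_le[of l]) (auto intro: inj_on_subset[OF inj])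
    then have R_le: "card R \<le> m" by simp
    define v where "v r j = zero_mode b j / b (2 * j + 1) * of_bool (j \<in> {i r..<e r})" for r j
    define q where "q = exp (\<delta> / 8 * L) / exp ((1 + \<delta>) * L)"
    have "card R \<le> M"
      unfolding M_def
    proof (rule card_small_singular_values_ge[OF nz _ \<open>0 < lam\<close> \<open>finite R\<close>, where v = v])
      fix c :: "nat \<Rightarrow> real" assume c: "\<exists>r\<in>R. c r \<noteq> 0"
      let ?x = "\<lambda>j. \<Sum>r\<in>R. c r * v r j"
      have valley': "i r \<le> l r \<and> l r < e r \<and> l r < m \<and> X (i r) - X (l r) \<ge> (1 + \<delta>) * L \<and>
          (e r < m \<longrightarrow> X (e r) - X (l r) \<ge> (1 + \<delta>) * L)" if "r \<in> R" for r
        using valley[of r] that by (auto simp: R_def m_def)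
      have "(\<Sum>j<m. (half_op b ?x j)\<^sup>2) \<le> 2 * card R * q\<^sup>2 * (\<Sum>j<m. (?x j)\<^sup>2)"
        unfolding v_def q_def
        using valley' good(2)
        by (intro half_op_test_functions(1)[OF nz X \<open>finite R\<close> _ disjoint, where l = l])
           (auto simp: R_def)
      also have "\<dots> < lam\<^sup>2 * (\<Sum>j<m. (?x j)\<^sup>2)"
      proof (rule mult_strict_right_mono)
        have "2 * card R * q\<^sup>2 = lam\<^sup>2 * (2 * card R * exp (- (7 / 4 * \<delta> * L)))"
          unfolding q_def L(2) power2_eq_square by (simp add: field_simps flip: exp_add exp_diff)
        also have "\<dots> < lam\<^sup>2 * 1"
        proof (rule mult_strict_left_mono)
          have "2 * card R * exp (- (7 / 4 * \<delta> * L)) \<le> 2 * (real n * exp (- (7 / 4 * \<delta> * L)))"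
            using R_le by (simp add: n m_def)
          also have "\<dots> < 1" using small[of "7 / 4 * \<delta> * L"] L(1) \<open>0 < \<delta>\<close> by simp
          finally show "2 * card R * exp (- (7 / 4 * \<delta> * L)) < 1" .
        qed (use \<open>0 < lam\<close> in simp)
        finally show "2 * card R * q\<^sup>2 < lam\<^sup>2" by simp
        show "0 < (\<Sum>j<m. (?x j)\<^sup>2)"
          unfolding v_def using valley' good(2) c
          by (intro half_op_test_functions(2)[OF nz X \<open>finite R\<close> _ disjoint, where l = l])
             (auto simp: R_def)
      qed
      finally show "(\<Sum>j<m. (half_op b ?x j)\<^sup>2) < lam\<^sup>2 * (\<Sum>j<m. (?x j)\<^sup>2)" .
    qed (simp add: m_def)
    with card_R show ?thesis by simp
  qed
  ultimately show ?thesis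
    unfolding Let_def M L_def[symmetric] X_def[symmetric] N_def[symmetric] D_def[symmetric]
      bad_def[symmetric] by simp
qed

end
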